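(* If $M$ is a Whittaker $\bar S_2$-module of type $\phi_{\mathbf 1}$, then $$M=U(\mathfrak h)\,\mathrm{Wh}_{\mathbf 1}(M)\cong U(\mathfrak h)\otimes\mathrm{Wh}_{\mathbf 1}(M),$$ the isomorphism being one of $U(\mathfrak h)$-modules.
   Context: $\bar S_2$ is the complex Lie algebra of polynomial vector fields $p_1\partial_1+p_2\partial_2$, $p_i\in\mathbb C[t_1,t_2]$, $\partial_i=\partial/\partial t_i$, with constant divergence $\partial_1(p_1)+\partial_2(p_2)\in\mathbb C$. $d_i=t_i\partial_i$ and $\mathfrak h=\mathbb Cd_1\oplus\mathbb Cd_2$. $\otimes=\otimes_{\mathbb C}$, and $U(\mathfrak h)$ acts on $U(\mathfrak h)\otimes \mathrm{Wh}_{\mathbf 1}(M)$ by left multiplication on the first factor. Let $\Delta_2=\mathrm{span}\{\partial_1,\partial_2\}$ and let $\phi_{\mathbf 1}:\Delta_2\to\mathbb C$ be the linear map with $\phi_{\mathbf 1}(\partial_1)=\phi_{\mathbf 1}(\partial_2)=1$. An $\bar S_2$-module $M$ is a Whittaker module if $\Delta_2$ acts locally finitely on it; it is of type $\phi_{\mathbf 1}$ if for every $v\in M$ and $x\in\Delta_2$, $(x-\phi_{\mathbf 1}(x))^kv=0$ for some $k\in\mathbb N$. $\mathrm{Wh}_{\mathbf 1}(M)=\{v\in M:\partial_1v=\partial_2v=v\}$. *)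

theory Defs
  imports
    Complex_Main
    "HOL-Library.Product_Plus"
    "HOL-Library.Poly_Mapping"
    "HOL-Computational_Algebra.Polynomial"
    "HOL-Algebra.QuotRing"
    "HOL-Algebra.Module"
begin

section \<open>Polynomial vector fields in two variables\<close>

text \<open>
  The ring \<open>\<complex>[t\<^sub>1,t\<^sub>2]\<close> is \<^typ>\<open>complex poly poly\<close>, with \<open>t\<^sub>1\<close> the inner and \<open>t\<^sub>2\<close>
  the outer variable. The vector field \<open>p\<^sub>1\<partial>\<^sub>1 + p\<^sub>2\<partial>\<^sub>2\<close> is the pair \<open>(p\<^sub>1, p\<^sub>2)\<close>; addition is the
  componentwise addition of \<^theory>\<open>HOL-Library.Product_Plus\<close>.
\<close>

type_synonym poly2 = "complex poly poly"
type_synonym vf = "poly2 \<times> poly2"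

definition t1 :: poly2 where "t1 = [:[:0, 1:]:]"
definition t2 :: poly2 where "t2 = [:0, 1:]"

definition D1 :: "poly2 \<Rightarrow> poly2" where "D1 p = map_poly pderiv p"
definition D2 :: "poly2 \<Rightarrow> poly2" where "D2 p = pderiv p"

definition vf_scale :: "complex \<Rightarrow> vf \<Rightarrow> vf"
  where "vf_scale c X = (Polynomial.smult [:c:] (fst X), Polynomial.smult [:c:] (snd X))"

definition vf_apply :: "vf \<Rightarrow> poly2 \<Rightarrow> poly2"
  where "vf_apply X f = fst X * D1 f + snd X * D2 f"

text \<open>The commutator of the derivations \<^term>\<open>vf_apply X\<close> and \<^term>\<open>vf_apply Y\<close>.\<close>
definition vf_bracket :: "vf \<Rightarrow> vf \<Rightarrow> vf"
  where "vf_bracket X Y =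
    (vf_apply X (fst Y) - vf_apply Y (fst X), vf_apply X (snd Y) - vf_apply Y (snd X))"

definition S2bar :: "vf set"
  where "S2bar = {X. \<exists>c::complex. D1 (fst X) + D2 (snd X) = [:[:c:]:]}"

definition del1 :: vf where "del1 = (1, 0)"
definition del2 :: vf where "del2 = (0, 1)"
definition d1 :: vf where "d1 = (t1, 0)"
definition d2 :: vf where "d2 = (0, t2)"

global_interpretation vf: vector_space vf_scale
  by unfold_locales
    (auto simp: vf_scale_def prod_eq_iff smult_add_right smult_add_left[symmetric] one_pCons[symmetric] mult.commute)

definition Delta2 :: "vf set" where "Delta2 = vf.span {del1, del2}"
definition cartan :: "vf set" where "cartan = vf.span {d1, d2}"

text \<open>On \<^const>\<open>Delta2\<close> both components are constant and this sends \<open>a\<partial>\<^sub>1 + b\<partial>\<^sub>2\<close> to \<open>a + b\<close>;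
  the values elsewhere are irrelevant.\<close>
definition phi1 :: "vf \<Rightarrow> complex"
  where "phi1 X = coeff (coeff (fst X) 0) 0 + coeff (coeff (snd X) 0) 0"

lemma phi1_linear: "Vector_Spaces.linear vf_scale (*) phi1"
  by unfold_locales (auto simp: phi1_def vf_scale_def algebra_simps)

lemma phi1_values [simp]: "phi1 del1 = 1" "phi1 del2 = 1"
  by (auto simp: phi1_def del1_def del2_def)

lemma coeff_D1: "coeff (D1 p) n = pderiv (coeff p n)"
  by (simp add: D1_def coeff_map_poly)

lemma D1_add: "D1 (p + q) = D1 p + D1 q"
  by (rule poly_eqI) (simp add: coeff_D1 pderiv_add)

lemma D1_diff: "D1 (p - q) = D1 p - D1 q"
  by (rule poly_eqI) (simp add: coeff_D1 pderiv_diff)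

lemma pderiv_sum': "pderiv (sum f A) = (\<Sum>x\<in>A. pderiv (f x))"
  by (induction A rule: infinite_finite_induct) (auto simp: pderiv_add)

lemma D1_mult: "D1 (p * q) = p * D1 q + D1 p * q"
  by (rule poly_eqI)
    (simp add: coeff_D1 coeff_mult pderiv_sum' pderiv_mult sum.distrib mult.commute[of "coeff q _"])

lemma D1_D2: "D1 (D2 p) = D2 (D1 p)"
  by (rule poly_eqI) (simp add: coeff_D1 D2_def coeff_pderiv pderiv_mult del: of_nat_Suc)

lemma D2_add: "D2 (p + q) = D2 p + D2 q"
  by (simp add: D2_def pderiv_add)

lemma D2_diff: "D2 (p - q) = D2 p - D2 q"
  by (simp add: D2_def pderiv_diff)

lemma D2_mult: "D2 (p * q) = p * D2 q + D2 p * q"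
  by (simp add: D2_def pderiv_mult algebra_simps)

lemmas D_simps = D1_add D1_diff D1_mult D1_D2 D2_add D2_diff D2_mult

lemma vf_bracket_apply:
  "vf_apply (vf_bracket X Y) f = vf_apply X (vf_apply Y f) - vf_apply Y (vf_apply X f)"
  by (simp add: vf_bracket_def vf_apply_def D_simps algebra_simps)

lemma vf_bracket_S2bar:
  assumes "X \<in> S2bar" "Y \<in> S2bar"
  shows "vf_bracket X Y \<in> S2bar"
proof -
  let ?div = "\<lambda>X. D1 (fst X) + D2 (snd X)"
  have "?div (vf_bracket X Y) = vf_apply X (?div Y) - vf_apply Y (?div X)"
    by (simp add: vf_bracket_def vf_apply_def D_simps algebra_simps)
  moreover have "vf_apply Z [:[:c:]:] = 0" for Z c
    by (simp add: vf_apply_def D1_def D2_def map_poly_pCons)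
  moreover obtain c d where "?div X = [:[:c:]:]" "?div Y = [:[:d:]:]"
    using assms by (auto simp: S2bar_def)
  ultimately have "?div (vf_bracket X Y) = 0" by simp
  then show ?thesis
    by (auto simp: S2bar_def intro!: exI[of _ 0])
qed

lemma S2bar_subspace: "vf.subspace S2bar"
proof (rule vf.subspaceI)
  show "0 \<in> S2bar"
    by (auto simp: S2bar_def D1_def D2_def intro!: exI[of _ 0])
next
  fix X Y assume "X \<in> S2bar" "Y \<in> S2bar"
  then obtain c d where "D1 (fst X) + D2 (snd X) = [:[:c:]:]" "D1 (fst Y) + D2 (snd Y) = [:[:d:]:]"
    by (auto simp: S2bar_def)
  moreover have "D1 (fst (X + Y)) + D2 (snd (X + Y)) =
      (D1 (fst X) + D2 (snd X)) + (D1 (fst Y) + D2 (snd Y))"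
    by (simp add: D_simps algebra_simps)
  ultimately show "X + Y \<in> S2bar"
    by (auto simp: S2bar_def intro!: exI[of _ "c + d"])
next
  fix a X assume "X \<in> S2bar"
  then obtain c where *: "D1 (fst X) + D2 (snd X) = [:[:c:]:]"
    by (auto simp: S2bar_def)
  have "D1 (Polynomial.smult [:a:] p) = Polynomial.smult [:a:] (D1 p)" for p
    by (rule poly_eqI) (simp add: coeff_D1 pderiv_smult)
  then have "D1 (fst (vf_scale a X)) + D2 (snd (vf_scale a X)) = Polynomial.smult [:a:] [:[:c:]:]"
    unfolding *[symmetric] by (simp add: vf_scale_def D2_def pderiv_smult smult_add_right)
  then show "vf_scale a X \<in> S2bar"
    by (auto simp: S2bar_def intro!: exI[of _ "a * c"])
qed

lemma Delta2_subset_S2bar: "Delta2 \<subseteq> S2bar"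
  unfolding Delta2_def
  by (rule vf.span_minimal[OF _ S2bar_subspace])
    (auto simp: S2bar_def del1_def del2_def D1_def D2_def map_poly_1 intro!: exI[of _ 0])

lemma cartan_subset_S2bar: "cartan \<subseteq> S2bar"
  unfolding cartan_def
  by (rule vf.span_minimal[OF _ S2bar_subspace])
    (auto simp: S2bar_def d1_def d2_def t1_def t2_def D1_def D2_def map_poly_pCons pderiv_pCons
      one_pCons intro!: exI[of _ 1])

lemma cartan_closed:
  "X \<in> cartan \<Longrightarrow> Y \<in> cartan \<Longrightarrow> X + Y \<in> cartan"
  "X \<in> cartan \<Longrightarrow> vf_scale c X \<in> cartan"
  "X \<in> cartan \<Longrightarrow> Y \<in> cartan \<Longrightarrow> vf_bracket X Y \<in> cartan"
proof -
  show "X \<in> cartan \<Longrightarrow> Y \<in> cartan \<Longrightarrow> X + Y \<in> cartan" "X \<in> cartan \<Longrightarrow> vf_scale c X \<in> cartan"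
    by (simp_all add: cartan_def vf.span_add vf.span_scale)
  have *: "\<exists>a b. Z = vf_scale a d1 + vf_scale b d2" if "Z \<in> cartan" for Z
  proof -
    obtain a where "Z - vf_scale a d1 \<in> vf.span {d2}"
      using \<open>Z \<in> cartan\<close> by (auto simp: cartan_def vf.span_breakdown_eq)
    then obtain b where "Z - vf_scale a d1 - vf_scale b d2 = 0"
      by (auto simp: vf.span_breakdown_eq)
    then show ?thesis by (metis add.commute diff_add_cancel eq_iff_diff_eq_0)
  qed
  have "vf_bracket (vf_scale a d1 + vf_scale b d2) (vf_scale a' d1 + vf_scale b' d2) = 0"
    for a b a' b'
    by (simp add: vf_bracket_def vf_apply_def vf_scale_def d1_def d2_def t1_def t2_def D1_def D2_def
        map_poly_pCons pderiv_pCons prod_eq_iff mult.commute)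
  then show "X \<in> cartan \<Longrightarrow> Y \<in> cartan \<Longrightarrow> vf_bracket X Y \<in> cartan"
    using *[of X] *[of Y] by (auto simp: cartan_def vf.span_zero)
qed

section \<open>Modules over a Lie algebra\<close>

text \<open>
  \<open>L\<close> is a Lie subalgebra of an ambient Lie algebra with scalar multiplication \<open>gscale\<close> and
  bracket \<open>br\<close>; the module is the whole type \<^typ>\<open>'m\<close>. Nothing is required of \<open>act x\<close> for \<open>x \<notin> L\<close>.
\<close>
locale lie_module = vector_space scale
  for scale :: "complex \<Rightarrow> 'm::ab_group_add \<Rightarrow> 'm" +
  fixes gscale :: "complex \<Rightarrow> 'g::ab_group_add \<Rightarrow> 'g"
    and br :: "'g \<Rightarrow> 'g \<Rightarrow> 'g"
    and L :: "'g set"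
    and act :: "'g \<Rightarrow> 'm \<Rightarrow> 'm"
  assumes act_linear: "x \<in> L \<Longrightarrow> Vector_Spaces.linear scale scale (act x)"
    and act_add: "x \<in> L \<Longrightarrow> y \<in> L \<Longrightarrow> act (x + y) v = act x v + act y v"
    and act_scale: "x \<in> L \<Longrightarrow> act (gscale c x) v = scale c (act x v)"
    and act_bracket: "x \<in> L \<Longrightarrow> y \<in> L \<Longrightarrow> act (br x y) v = act x (act y v) - act y (act x v)"

abbreviation S2bar_module :: "(complex \<Rightarrow> 'm::ab_group_add \<Rightarrow> 'm) \<Rightarrow> (vf \<Rightarrow> 'm \<Rightarrow> 'm) \<Rightarrow> bool"
  where "S2bar_module scale act \<equiv> lie_module scale vf_scale vf_bracket S2bar act"

text \<open>Every vector lies in a finite-dimensional \<open>X\<close>-invariant subspace.\<close>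
definition locally_finite_on ::
    "(complex \<Rightarrow> 'm::ab_group_add \<Rightarrow> 'm) \<Rightarrow> ('g \<Rightarrow> 'm \<Rightarrow> 'm) \<Rightarrow> 'g set \<Rightarrow> bool"
  where "locally_finite_on scale act X \<longleftrightarrow>
    (\<forall>v. \<exists>B. finite B \<and> v \<in> Modules.module.span scale B \<and>
      (\<forall>x\<in>X. \<forall>w\<in>Modules.module.span scale B. act x w \<in> Modules.module.span scale B))"

definition whittaker_module ::
    "(complex \<Rightarrow> 'm::ab_group_add \<Rightarrow> 'm) \<Rightarrow> (vf \<Rightarrow> 'm \<Rightarrow> 'm) \<Rightarrow> bool"
  where "whittaker_module scale act \<longleftrightarrow>
    S2bar_module scale act \<and> locally_finite_on scale act Delta2"

definition whittaker_type ::
    "(complex \<Rightarrow> 'm::ab_group_add \<Rightarrow> 'm) \<Rightarrow> (vf \<Rightarrow> 'm \<Rightarrow> 'm) \<Rightarrow> (vf \<Rightarrow> complex) \<Rightarrow> bool"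
  where "whittaker_type scale act \<phi> \<longleftrightarrow>
    (\<forall>v. \<forall>x\<in>Delta2. \<exists>k::nat. ((\<lambda>w. act x w - scale (\<phi> x) w) ^^ k) v = 0)"

definition Wh1 :: "(vf \<Rightarrow> 'm \<Rightarrow> 'm) \<Rightarrow> 'm set"
  where "Wh1 act = {v. act del1 v = v \<and> act del2 v = v}"

section \<open>Universal enveloping algebras\<close>

text \<open>
  The product of \<^type>\<open>poly_mapping\<close> is the convolution over an additively written monoid. The
  free monoid is therefore written additively (noncommutatively), with concatenation as \<open>+\<close>.
\<close>
datatype 'g word = Word (letters: "'g list")

instantiation word :: (type) monoid_add
begin
definition zero_word_def: "0 = Word []"
definition plus_word_def: "u + v = Word (letters u @ letters v)"
instance
  by intro_classes (auto simp: zero_word_def plus_word_def)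
end

text \<open>The free associative unital complex algebra on the set \<open>L\<close>.\<close>
definition free_algebra :: "'g set \<Rightarrow> ('g word \<Rightarrow>\<^sub>0 complex) ring"
  where "free_algebra L =
    \<lparr>carrier = {f. \<forall>w\<in>Poly_Mapping.keys f. set (letters w) \<subseteq> L}, mult = (*), one = 1, zero = 0, add = (+)\<rparr>"

definition letter :: "'g \<Rightarrow> 'g word \<Rightarrow>\<^sub>0 complex"
  where "letter x = Poly_Mapping.single (Word [x]) 1"

definition scalar :: "complex \<Rightarrow> 'g word \<Rightarrow>\<^sub>0 complex"
  where "scalar c = Poly_Mapping.single 0 c"

text \<open>
  The letters are the elements of the Lie algebra, not of a basis of it. The first two families of
  relations turn the free algebra into the tensor algebra of the vector space \<open>L\<close>.
\<close>
definition env_relations ::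
    "(complex \<Rightarrow> 'g::ab_group_add \<Rightarrow> 'g) \<Rightarrow> ('g \<Rightarrow> 'g \<Rightarrow> 'g) \<Rightarrow> 'g set \<Rightarrow> ('g word \<Rightarrow>\<^sub>0 complex) set"
  where "env_relations gscale br L =
    {letter (x + y) - letter x - letter y | x y. x \<in> L \<and> y \<in> L} \<union>
    {letter (gscale c x) - scalar c * letter x | c x. x \<in> L} \<union>
    {letter x * letter y - letter y * letter x - letter (br x y) | x y. x \<in> L \<and> y \<in> L}"

definition env_ideal ::
    "(complex \<Rightarrow> 'g::ab_group_add \<Rightarrow> 'g) \<Rightarrow> ('g \<Rightarrow> 'g \<Rightarrow> 'g) \<Rightarrow> 'g set \<Rightarrow> ('g word \<Rightarrow>\<^sub>0 complex) set"
  where "env_ideal gscale br L = Idl\<^bsub>free_algebra L\<^esub> (env_relations gscale br L)"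

text \<open>
  The universal enveloping algebra of \<open>L\<close>. The record type \<^typ>\<open>(complex, 'u) module\<close> extends that
  of rings, so it carries both the ring structure and the scalar multiplication.
\<close>
definition envelope ::
    "(complex \<Rightarrow> 'g::ab_group_add \<Rightarrow> 'g) \<Rightarrow> ('g \<Rightarrow> 'g \<Rightarrow> 'g) \<Rightarrow> 'g set
      \<Rightarrow> (complex, ('g word \<Rightarrow>\<^sub>0 complex) set) module"
  where "envelope gscale br L =
    (let F = free_algebra L; I = env_ideal gscale br L; U = F Quot I in
      \<lparr>carrier = carrier U, mult = mult U, one = one U, zero = zero U, add = add U,
       smult = (\<lambda>c u. mult U (I +>\<^bsub>F\<^esub> scalar c) u)\<rparr>)"

text \<open>The action of the free algebra, then of the enveloping algebra, on a module over \<open>L\<close>. In the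
  latter, \<^const>\<open>the_elem\<close> picks the common value over all representatives (see \<open>env_act_coset\<close>).\<close>
definition free_act ::
    "(complex \<Rightarrow> 'm::ab_group_add \<Rightarrow> 'm) \<Rightarrow> ('g \<Rightarrow> 'm \<Rightarrow> 'm) \<Rightarrow> ('g word \<Rightarrow>\<^sub>0 complex) \<Rightarrow> 'm \<Rightarrow> 'm"
  where "free_act scale act f v =
    (\<Sum>w\<in>Poly_Mapping.keys f. scale (Poly_Mapping.lookup f w) (foldr act (letters w) v))"

definition env_act ::
    "(complex \<Rightarrow> 'm::ab_group_add \<Rightarrow> 'm) \<Rightarrow> ('g \<Rightarrow> 'm \<Rightarrow> 'm) \<Rightarrow> ('g word \<Rightarrow>\<^sub>0 complex) set \<Rightarrow> 'm \<Rightarrow> 'm"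
  where "env_act scale act u v = the_elem ((\<lambda>f. free_act scale act f v) ` u)"

lemma ring_free_algebra: "ring (free_algebra L)"
proof (rule ringI)
  show "abelian_group (free_algebra L)"
  proof (rule abelian_groupI)
    fix x assume "x \<in> carrier (free_algebra L)"
    then show "\<exists>y\<in>carrier (free_algebra L). y \<oplus>\<^bsub>free_algebra L\<^esub> x = \<zero>\<^bsub>free_algebra L\<^esub>"
      by (intro bexI[of _ "- x"]) (auto simp: free_algebra_def in_keys_iff)
  qed (use keys_add in \<open>fastforce simp: free_algebra_def algebra_simps\<close>)+
  show "monoid (free_algebra L)"
  proof (rule monoidI)
    fix f g assume "f \<in> carrier (free_algebra L)" "g \<in> carrier (free_algebra L)"
    then show "f \<otimes>\<^bsub>free_algebra L\<^esub> g \<in> carrier (free_algebra L)"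
      using keys_mult[of f g] by (fastforce simp: free_algebra_def plus_word_def)
  qed (auto simp: free_algebra_def zero_word_def algebra_simps)
qed (auto simp: free_algebra_def algebra_simps)

lemma poly_mapping_keys_induct [consumes 1, case_names zero single add]:
  fixes f :: "'k \<Rightarrow>\<^sub>0 'b::comm_monoid_add"
  assumes "Poly_Mapping.keys f \<subseteq> S"
    and "P 0" "\<And>k c. k \<in> S \<Longrightarrow> P (Poly_Mapping.single k c)" "\<And>f g. P f \<Longrightarrow> P g \<Longrightarrow> P (f + g)"
  shows "P f"
proof -
  have "P (\<Sum>k\<in>A. Poly_Mapping.single k (Poly_Mapping.lookup f k))" if "finite A" "A \<subseteq> S" for A
    using that by (induction rule: finite_induct) (auto intro: assms(2-4))
  moreover have "(\<Sum>k\<in>Poly_Mapping.keys f. Poly_Mapping.single k (Poly_Mapping.lookup f k)) = f"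
    by (rule poly_mapping_eqI)
      (auto simp: lookup_sum lookup_single when_def in_keys_iff sum.delta' intro: sum.neutral)
  ultimately show ?thesis
    using assms(1) by (metis finite_keys)
qed

context lie_module
begin

lemma free_act_superset:
  assumes "finite S" "Poly_Mapping.keys f \<subseteq> S"
  shows "free_act scale act f v =
    (\<Sum>w\<in>S. scale (Poly_Mapping.lookup f w) (foldr act (letters w) v))"
  unfolding free_act_def using assms by (intro sum.mono_neutral_left) (auto simp: in_keys_iff)

lemma free_act_zero [simp]: "free_act scale act 0 v = 0"
  by (simp add: free_act_def)

lemma free_act_single [simp]:
  "free_act scale act (Poly_Mapping.single w c) v = scale c (foldr act (letters w) v)"
  by (simp add: free_act_def)

lemma free_act_add:
  "free_act scale act (f + g) v = free_act scale act f v + free_act scale act g v"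
  by (simp add: free_act_superset[of "Poly_Mapping.keys f \<union> Poly_Mapping.keys g"] keys_add
      lookup_add scale_left_distrib sum.distrib)

lemma free_act_uminus: "free_act scale act (- f) v = - free_act scale act f v"
  using free_act_add[of "- f" f v] by (simp add: eq_neg_iff_add_eq_0)

lemma free_act_diff:
  "free_act scale act (f - g) v = free_act scale act f v - free_act scale act g v"
  using free_act_add[of f "- g" v] by (simp add: free_act_uminus)

lemma foldr_act_linear: "set xs \<subseteq> L \<Longrightarrow> Vector_Spaces.linear scale scale (foldr act xs)"
proof (induction xs)
  case Nil
  show ?case using linear_id by (simp add: id_def)
next
  case (Cons x xs)
  then show ?case
    using Vector_Spaces.linear_compose[of scale scale "foldr act xs" scale "act x"] act_linear[of x]
    by (simp add: o_def)
qed

lemma free_act_letters_linear: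
  assumes "f \<in> carrier (free_algebra L)"
  shows "Vector_Spaces.linear scale scale (free_act scale act f)"
proof -
  have lin: "Vector_Spaces.linear scale scale (foldr act (letters w))"
    if "w \<in> Poly_Mapping.keys f" for w
    using assms that by (intro foldr_act_linear) (auto simp: free_algebra_def)
  show ?thesis
    by unfold_locales
      (auto simp: free_act_def module_hom.add[OF module_hom_iff_linear[THEN iffD2, OF lin]]
        module_hom.scale[OF module_hom_iff_linear[THEN iffD2, OF lin]] scale_right_distrib sum.distrib
        scale_sum_right mult.commute)
qed

lemma free_act_mult:
  assumes "f \<in> carrier (free_algebra L)"
  shows "free_act scale act (f * g) v = free_act scale act f (free_act scale act g v)"
proof -
  have "Poly_Mapping.keys f \<subseteq> {w. set (letters w) \<subseteq> L}"
    using assms by (auto simp: free_algebra_def)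
  then show ?thesis
  proof (induction f rule: poly_mapping_keys_induct)
    case (single u a)
    then interpret u: Vector_Spaces.linear scale scale "foldr act (letters u)"
      by (intro foldr_act_linear) auto
    have "Poly_Mapping.keys g \<subseteq> UNIV" by simp
    then show ?case
      by (induction g rule: poly_mapping_keys_induct)
        (auto simp: mult_single plus_word_def u.scale u.add u.zero free_act_add
          distrib_left scale_right_distrib)
  qed (simp_all add: free_act_add distrib_right)
qed

lemma free_act_env_ideal:
  assumes closed: "\<And>x y. x \<in> L \<Longrightarrow> y \<in> L \<Longrightarrow> x + y \<in> L" "\<And>c x. x \<in> L \<Longrightarrow> gscale c x \<in> L"
    "\<And>x y. x \<in> L \<Longrightarrow> y \<in> L \<Longrightarrow> br x y \<in> L"
  shows "env_ideal gscale br L \<subseteq> {f \<in> carrier (free_algebra L). \<forall>v. free_act scale act f v = 0}"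
    (is "_ \<subseteq> ?K")
proof -
  interpret F: ring "free_algebra L" by (rule ring_free_algebra)
  have minus: "x - y \<in> carrier (free_algebra L)"
    if "x \<in> carrier (free_algebra L)" "y \<in> carrier (free_algebra L)" for x y
    using that keys_diff[of x y] by (auto simp: free_algebra_def)
  have uminus: "\<ominus>\<^bsub>free_algebra L\<^esub> x = - x" if "x \<in> carrier (free_algebra L)" for x
    using that minus[OF F.zero_closed that]
    by (intro F.minus_equality) (auto simp: free_algebra_def)
  have "ideal ?K (free_algebra L)"
  proof (rule idealI[OF ring_free_algebra])
    show "subgroup ?K (add_monoid (free_algebra L))"
    proof (rule F.add.subgroupI)
      show "?K \<noteq> {}" using F.zero_closed by (auto simp: free_algebra_def intro!: exI[of _ 0])
    next
      fix a assume "a \<in> ?K"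
      then show "\<ominus>\<^bsub>free_algebra L\<^esub> a \<in> ?K"
        using F.a_inv_closed[of a] by (auto simp: uminus free_act_uminus)
    next
      fix a b assume "a \<in> ?K" "b \<in> ?K"
      then show "a \<oplus>\<^bsub>free_algebra L\<^esub> b \<in> ?K"
        using F.a_closed[of a b] by (auto simp: free_act_add free_algebra_def)
    qed auto
  next
    fix a x assume a: "a \<in> ?K" and x: "x \<in> carrier (free_algebra L)"
    interpret x: Vector_Spaces.linear scale scale "free_act scale act x"
      by (rule free_act_letters_linear[OF x])
    have mult: "g \<otimes>\<^bsub>free_algebra L\<^esub> h = g * h" for g h
      by (simp add: free_algebra_def)
    have a0: "a \<in> carrier (free_algebra L)" "free_act scale act a v = 0" for v
      using a by auto
    show "x \<otimes>\<^bsub>free_algebra L\<^esub> a \<in> ?K"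
      using F.m_closed[OF x a0(1)] by (simp add: mult free_act_mult[OF x] a0(2) x.zero)
    show "a \<otimes>\<^bsub>free_algebra L\<^esub> x \<in> ?K"
      using F.m_closed[OF a0(1) x] by (simp add: mult free_act_mult[OF a0(1)] a0(2))
  qed
  moreover have "env_relations gscale br L \<subseteq> ?K"
  proof -
    have l: "letter x \<in> carrier (free_algebra L)" if "x \<in> L" for x
      using that by (simp add: letter_def free_algebra_def)
    have s: "scalar c \<in> carrier (free_algebra L)" for c
      by (simp add: scalar_def free_algebra_def zero_word_def)
    have m: "x * y \<in> carrier (free_algebra L)"
      if "x \<in> carrier (free_algebra L)" "y \<in> carrier (free_algebra L)" for x y
      using F.m_closed[OF that] by (simp add: free_algebra_def)
    have fl: "free_act scale act (letter x) v = act x v" for x v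
      by (simp add: letter_def)
    have fs: "free_act scale act (scalar c) v = scale c v" for c v
      by (simp add: scalar_def zero_word_def)
    have "letter (x + y) - letter x - letter y \<in> ?K" if "x \<in> L" "y \<in> L" for x y
      using minus[OF minus[OF l l] l, of "x + y" x y] that
      by (simp add: closed free_act_diff fl act_add)
    moreover have "letter (gscale c x) - scalar c * letter x \<in> ?K" if "x \<in> L" for c x
      using minus[OF l m[OF s l], of "gscale c x" x c] that
      by (simp add: closed free_act_diff free_act_mult s fl fs act_scale)
    moreover have "letter x * letter y - letter y * letter x - letter (br x y) \<in> ?K"
      if "x \<in> L" "y \<in> L" for x y
      using minus[OF minus[OF m[OF l l] m[OF l l]] l, of x y y x "br x y"] that
      by (simp add: closed free_act_diff free_act_mult l fl act_bracket)
    ultimately show ?thesis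
      unfolding env_relations_def by blast
  qed
  ultimately show ?thesis
    unfolding env_ideal_def by (rule F.genideal_minimal)
qed

lemma env_act_coset:
  assumes closed: "\<And>x y. x \<in> L \<Longrightarrow> y \<in> L \<Longrightarrow> x + y \<in> L" "\<And>c x. x \<in> L \<Longrightarrow> gscale c x \<in> L"
    "\<And>x y. x \<in> L \<Longrightarrow> y \<in> L \<Longrightarrow> br x y \<in> L"
  shows "env_act scale act (env_ideal gscale br L +>\<^bsub>free_algebra L\<^esub> f) v = free_act scale act f v"
proof -
  have "0 \<in> env_ideal gscale br L"
    unfolding env_ideal_def genideal_def
    using additive_subgroup.zero_closed[OF ideal.axioms(1)] by (fastforce simp: free_algebra_def)
  then have "(\<lambda>f. free_act scale act f v) ` (env_ideal gscale br L +>\<^bsub>free_algebra L\<^esub> f) =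
      {free_act scale act f v}"
    using free_act_env_ideal[OF closed]
    by (force simp: a_r_coset_def r_coset_def free_algebra_def free_act_add image_iff)
  then show ?thesis by (simp add: env_act_def)
qed

end

text \<open>The subspace \<open>U N\<close> spanned by the products \<open>u w\<close>.\<close>
definition env_generated ::
    "(complex \<Rightarrow> 'm::ab_group_add \<Rightarrow> 'm) \<Rightarrow> ('g \<Rightarrow> 'm \<Rightarrow> 'm)
      \<Rightarrow> (complex, ('g word \<Rightarrow>\<^sub>0 complex) set) module \<Rightarrow> 'm set \<Rightarrow> 'm set"
  where "env_generated scale act U N =
    Modules.module.span scale {env_act scale act u w | u w. u \<in> carrier U \<and> w \<in> N}"

text \<open>The whole type \<^typ>\<open>'m\<close> as a module over an enveloping algebra. Here and below, the fields
  \<^const>\<open>mult\<close> and \<^const>\<open>one\<close> of module records have no meaning.\<close>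
definition env_module ::
    "(complex \<Rightarrow> 'm::ab_group_add \<Rightarrow> 'm) \<Rightarrow> ('g \<Rightarrow> 'm \<Rightarrow> 'm)
      \<Rightarrow> (('g word \<Rightarrow>\<^sub>0 complex) set, 'm) module"
  where "env_module scale act =
    \<lparr>carrier = UNIV, mult = undefined, one = undefined, zero = 0, add = (+),
     smult = env_act scale act\<rparr>"

definition subspace_module ::
    "(complex \<Rightarrow> 'm::ab_group_add \<Rightarrow> 'm) \<Rightarrow> 'm set \<Rightarrow> (complex, 'm) module"
  where "subspace_module scale W =
    \<lparr>carrier = W, mult = undefined, one = undefined, zero = 0, add = (+), smult = scale\<rparr>"

section \<open>Tensor products over the complex numbers\<close>

definition pm_scale :: "complex \<Rightarrow> ('k \<Rightarrow>\<^sub>0 complex) \<Rightarrow> ('k \<Rightarrow>\<^sub>0 complex)"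
  where "pm_scale c f = Poly_Mapping.map ((*) c) f"

lemma lookup_pm_scale [simp]:
  "Poly_Mapping.lookup (pm_scale c f) k = c * Poly_Mapping.lookup f k"
  by (auto simp: pm_scale_def Poly_Mapping.map.rep_eq when_def)

global_interpretation pm: vector_space "pm_scale :: complex \<Rightarrow> ('k \<Rightarrow>\<^sub>0 complex) \<Rightarrow> _"
  by unfold_locales (auto intro!: poly_mapping_eqI simp: lookup_add algebra_simps)

lemma pm_scale_single [simp]:
  "pm_scale c (Poly_Mapping.single k x) = Poly_Mapping.single k (c * x)"
  by (simp add: pm_scale_def)

definition free_space :: "'k set \<Rightarrow> (complex, 'k \<Rightarrow>\<^sub>0 complex) module"
  where "free_space S =
    \<lparr>carrier = {f. Poly_Mapping.keys f \<subseteq> S}, mult = undefined, one = undefined, zero = 0, add = (+),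
     smult = pm_scale\<rparr>"

abbreviation pure :: "'a \<Rightarrow> 'b \<Rightarrow> ('a \<times> 'b) \<Rightarrow>\<^sub>0 complex"
  where "pure v w \<equiv> Poly_Mapping.single (v, w) 1"

definition tensor_relations ::
    "(complex, 'a) module \<Rightarrow> (complex, 'b) module \<Rightarrow> (('a \<times> 'b) \<Rightarrow>\<^sub>0 complex) set"
  where "tensor_relations V W = pm.span (
    {pure (v \<oplus>\<^bsub>V\<^esub> v') w - pure v w - pure v' w | v v' w.
       v \<in> carrier V \<and> v' \<in> carrier V \<and> w \<in> carrier W} \<union>
    {pure v (w \<oplus>\<^bsub>W\<^esub> w') - pure v w - pure v w' | v w w'.
       v \<in> carrier V \<and> w \<in> carrier W \<and> w' \<in> carrier W} \<union>
    {pure (c \<odot>\<^bsub>V\<^esub> v) w - pm_scale c (pure v w) | c v w. v \<in> carrier V \<and> w \<in> carrier W} \<union>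
    {pure v (c \<odot>\<^bsub>W\<^esub> w) - pm_scale c (pure v w) | c v w. v \<in> carrier V \<and> w \<in> carrier W})"

text \<open>Left multiplication by \<open>a\<close> on the first factor, on the level of representatives.\<close>
definition lmult_first :: "('a, 'z) ring_scheme \<Rightarrow> 'a \<Rightarrow> (('a \<times> 'b) \<Rightarrow>\<^sub>0 complex) \<Rightarrow> (('a \<times> 'b) \<Rightarrow>\<^sub>0 complex)"
  where "lmult_first A a f =
    (\<Sum>k\<in>Poly_Mapping.keys f. Poly_Mapping.single (a \<otimes>\<^bsub>A\<^esub> fst k, snd k) (Poly_Mapping.lookup f k))"

text \<open>
  The tensor product \<open>A \<otimes> W\<close> of a complex algebra \<open>A\<close> and a complex vector space \<open>W\<close>, as a module
  over \<open>A\<close>. As in \<^const>\<open>rcoset_mult\<close>, the union runs over equal cosets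
  (see \<open>tensor_smult_coset\<close>).
\<close>
definition tensor_module ::
    "(complex, 'a) module \<Rightarrow> (complex, 'b) module \<Rightarrow> ('a, (('a \<times> 'b) \<Rightarrow>\<^sub>0 complex) set) module"
  where "tensor_module A W =
    (let F = free_space (carrier A \<times> carrier W); R = tensor_relations A W in
      \<lparr>carrier = a_rcosets\<^bsub>F\<^esub> R, mult = undefined, one = undefined, zero = R, add = set_add F,
       smult = (\<lambda>a X. \<Union>f\<in>X. R +>\<^bsub>F\<^esub> lmult_first A a f)\<rparr>)"

lemma lmult_first_superset:
  assumes "finite S" "Poly_Mapping.keys f \<subseteq> S"
  shows "lmult_first A a f =
    (\<Sum>k\<in>S. Poly_Mapping.single (a \<otimes>\<^bsub>A\<^esub> fst k, snd k) (Poly_Mapping.lookup f k))"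
  unfolding lmult_first_def using assms by (intro sum.mono_neutral_left) (auto simp: in_keys_iff)

lemma lmult_first_linear: "Vector_Spaces.linear pm_scale pm_scale (lmult_first A a)"
proof unfold_locales
  fix f g
  show "lmult_first A a (f + g) = lmult_first A a f + lmult_first A a g"
    by (simp add: lmult_first_superset[of "Poly_Mapping.keys f \<union> Poly_Mapping.keys g"] keys_add
        lookup_add single_add sum.distrib)
next
  fix c f
  show "lmult_first A a (pm_scale c f) = pm_scale c (lmult_first A a f)"
    by (subst lmult_first_superset[of "Poly_Mapping.keys f"])
      (auto simp: lmult_first_def in_keys_iff pm.scale_sum_right)
qed

lemma lmult_first_relations:
  fixes A :: "(complex, 'a) module" and W :: "(complex, 'b) module"
  assumes "ring A" and a: "a \<in> carrier A"
    and smult: "\<And>c u. u \<in> carrier A \<Longrightarrow> a \<otimes>\<^bsub>A\<^esub> (c \<odot>\<^bsub>A\<^esub> u) = c \<odot>\<^bsub>A\<^esub> (a \<otimes>\<^bsub>A\<^esub> u)"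
    and f: "f \<in> tensor_relations A W"
  shows "lmult_first A a f \<in> tensor_relations A W"
proof -
  interpret A: ring A by fact
  interpret l: Vector_Spaces.linear pm_scale pm_scale "lmult_first A a"
    by (rule lmult_first_linear)
  have scale: "lmult_first A a (Poly_Mapping.single (v, w) c) = Poly_Mapping.single (a \<otimes>\<^bsub>A\<^esub> v, w) c"
    for v and w :: 'b and c
    by (simp add: lmult_first_def)
  have closed: "a \<otimes>\<^bsub>A\<^esub> v \<in> carrier A" if "v \<in> carrier A" for v
    using a that by simp
  show ?thesis
    using f unfolding tensor_relations_def
  proof (induction rule: pm.span_induct_alt)
    case base
    show ?case by (simp only: l.zero pm.span_zero)
  next
    case (step c x y)
    show ?case
      unfolding l.add l.scale
    proof (intro pm.span_add[OF pm.span_scale step.IH] pm.span_base, goal_cases)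
      case 1
      from step.hyps(1) show ?case
      proof (elim UnE, goal_cases)
        case 1
        then obtain v v' w where x: "x = pure (v \<oplus>\<^bsub>A\<^esub> v') w - pure v w - pure v' w"
            and carr: "v \<in> carrier A" "v' \<in> carrier A" "w \<in> carrier W"
          by blast
        have eq: "lmult_first A a x =
            pure (a \<otimes>\<^bsub>A\<^esub> v \<oplus>\<^bsub>A\<^esub> a \<otimes>\<^bsub>A\<^esub> v') w - pure (a \<otimes>\<^bsub>A\<^esub> v) w - pure (a \<otimes>\<^bsub>A\<^esub> v') w"
          using carr a by (simp add: x l.diff scale A.r_distr)
        show ?case
          unfolding eq using closed carr by blast
      next
        case 2
        then obtain v w w' where x: "x = pure v (w \<oplus>\<^bsub>W\<^esub> w') - pure v w - pure v w'"
            and carr: "v \<in> carrier A" "w \<in> carrier W" "w' \<in> carrier W"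
          by blast
        have eq: "lmult_first A a x =
            pure (a \<otimes>\<^bsub>A\<^esub> v) (w \<oplus>\<^bsub>W\<^esub> w') - pure (a \<otimes>\<^bsub>A\<^esub> v) w - pure (a \<otimes>\<^bsub>A\<^esub> v) w'"
          by (simp add: x l.diff scale)
        show ?case
          unfolding eq using closed carr by blast
      next
        case 3
        then obtain d v w where x: "x = pure (d \<odot>\<^bsub>A\<^esub> v) w - pm_scale d (pure v w)"
            and carr: "v \<in> carrier A" "w \<in> carrier W"
          by blast
        have eq: "lmult_first A a x = pure (d \<odot>\<^bsub>A\<^esub> (a \<otimes>\<^bsub>A\<^esub> v)) w - pm_scale d (pure (a \<otimes>\<^bsub>A\<^esub> v) w)"
          using carr by (simp add: x l.diff scale smult)
        show ?case
          unfolding eq using closed carr by blast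
      next
        case 4
        then obtain d v w where x: "x = pure v (d \<odot>\<^bsub>W\<^esub> w) - pm_scale d (pure v w)"
            and carr: "v \<in> carrier A" "w \<in> carrier W"
          by blast
        have eq: "lmult_first A a x = pure (a \<otimes>\<^bsub>A\<^esub> v) (d \<odot>\<^bsub>W\<^esub> w) - pm_scale d (pure (a \<otimes>\<^bsub>A\<^esub> v) w)"
          by (simp add: x l.diff scale)
        show ?case
          unfolding eq using closed carr by blast
      qed
    qed
  qed
qed

lemma tensor_smult_coset:
  fixes A :: "(complex, 'a) module" and W :: "(complex, 'b) module"
  assumes "ring A" "a \<in> carrier A"
    and "\<And>c u. u \<in> carrier A \<Longrightarrow> a \<otimes>\<^bsub>A\<^esub> (c \<odot>\<^bsub>A\<^esub> u) = c \<odot>\<^bsub>A\<^esub> (a \<otimes>\<^bsub>A\<^esub> u)"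
  defines "F \<equiv> free_space (carrier A \<times> carrier W)" and "R \<equiv> tensor_relations A W"
  shows "a \<odot>\<^bsub>tensor_module A W\<^esub> (R +>\<^bsub>F\<^esub> f) = R +>\<^bsub>F\<^esub> lmult_first A a f"
proof -
  interpret l: Vector_Spaces.linear pm_scale pm_scale "lmult_first A a"
    by (rule lmult_first_linear)
  have coset: "R +>\<^bsub>F\<^esub> g = {r + g | r. r \<in> R}" for g
    by (auto simp: F_def free_space_def a_r_coset_def r_coset_def)
  have R: "0 \<in> R" "\<And>x y. x \<in> R \<Longrightarrow> y \<in> R \<Longrightarrow> x + y \<in> R" "\<And>x y. x \<in> R \<Longrightarrow> y \<in> R \<Longrightarrow> x - y \<in> R"
    by (auto simp: R_def tensor_relations_def pm.span_zero pm.span_add pm.span_diff)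
  have "R +>\<^bsub>F\<^esub> lmult_first A a (r + f) = R +>\<^bsub>F\<^esub> lmult_first A a f" if "r \<in> R" for r
  proof -
    have "lmult_first A a r \<in> R"
      using lmult_first_relations[OF assms(1-3)] that by (simp add: R_def)
    moreover have "{r' + (g + h) | r'. r' \<in> R} = {r' + h | r'. r' \<in> R}" if "g \<in> R" for g h
    proof (intro subset_antisym subsetI)
      fix x assume "x \<in> {r' + (g + h) | r'. r' \<in> R}"
      then obtain r' where "r' \<in> R" "x = (r' + g) + h" by (auto simp: add.assoc)
      then show "x \<in> {r' + h | r'. r' \<in> R}" using R(2) \<open>g \<in> R\<close> by blast
    next
      fix x assume "x \<in> {r' + h | r'. r' \<in> R}"
      then obtain r' where "r' \<in> R" "x = (r' - g) + (g + h)" by (auto simp: algebra_simps)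
      then show "x \<in> {r' + (g + h) | r'. r' \<in> R}" using R(3) \<open>g \<in> R\<close> by blast
    qed
    ultimately show ?thesis
      unfolding coset l.add by blast
  qed
  moreover have "a \<odot>\<^bsub>tensor_module A W\<^esub> X = (\<Union>f\<in>X. R +>\<^bsub>F\<^esub> lmult_first A a f)" for X
    by (simp add: tensor_module_def Let_def F_def R_def)
  ultimately show ?thesis
    using R(1) unfolding coset[of f] by auto
qed

section \<open>Isomorphisms of modules\<close>

definition module_iso ::
    "('a, 'z) ring_scheme \<Rightarrow> ('a, 'm) module \<Rightarrow> ('a, 'n) module \<Rightarrow> ('m \<Rightarrow> 'n) set"
  where "module_iso A M N =
    {f. bij_betw f (carrier M) (carrier N) \<and>
        (\<forall>x\<in>carrier M. \<forall>y\<in>carrier M. f (x \<oplus>\<^bsub>M\<^esub> y) = f x \<oplus>\<^bsub>N\<^esub> f y) \<and>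
        (\<forall>a\<in>carrier A. \<forall>x\<in>carrier M. f (a \<odot>\<^bsub>M\<^esub> x) = a \<odot>\<^bsub>N\<^esub> f x)}"

definition module_isomorphic ::
    "('a, 'z) ring_scheme \<Rightarrow> ('a, 'm) module \<Rightarrow> ('a, 'n) module \<Rightarrow> bool"
  where "module_isomorphic A M N \<longleftrightarrow> module_iso A M N \<noteq> {}"

abbreviation U_cartan :: "(complex, (vf word \<Rightarrow>\<^sub>0 complex) set) module"
  where "U_cartan \<equiv> envelope vf_scale vf_bracket cartan"

end

theory Submission
  imports Defs
begin

text \<open>
  From \<open>[\<partial>\<^sub>1, d\<^sub>1] = \<partial>\<^sub>1\<close> one gets \<open>\<partial>\<^sub>1 f(d\<^sub>1) w = f(d\<^sub>1 + 1) w\<close> whenever \<open>\<partial>\<^sub>1 w = w\<close>, so \<open>N\<^sub>1 = \<partial>\<^sub>1 - 1\<close> acts on polynomials in \<open>d\<^sub>1\<close>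
  applied to \<open>w\<close> as the forward difference operator, and it sends the falling factorial
  \<open>(d\<^sub>1)\<^sub>n = d\<^sub>1 (d\<^sub>1 - 1) \<cdots> (d\<^sub>1 - n + 1)\<close> to \<open>n (d\<^sub>1)\<^bsub>n-1\<^esub>\<close>. The pair \<open>(\<partial>\<^sub>2, d\<^sub>2)\<close> behaves in the same way, and
  both operators of one pair commute with both operators of the other. The type of the module says
  that \<open>N\<^sub>1\<close> and \<open>N\<^sub>2\<close> are locally nilpotent.

  Two facts follow as for polynomials. Every vector is a sum of vectors \<open>(d\<^sub>1)\<^sub>i (d\<^sub>2)\<^sub>j w\<close> with \<open>w\<close> a
  Whittaker vector (\<open>nilpotent_in_span_falling2\<close>): if \<open>N\<^sub>1\<^bsup>n+1\<^esup> v = 0\<close>, then \<open>w = N\<^sub>1\<^sup>n v / n!\<close> is fixed by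
  \<open>\<partial>\<^sub>1\<close> and \<open>v - (d\<^sub>1)\<^sub>n w\<close> is killed by \<open>N\<^sub>1\<^sup>n\<close>; this is the discrete Taylor expansion. And the vectors
  \<open>w\<^sub>i\<^sub>j\<close> in such a sum are unique (\<open>falling2_independent\<close>): applying \<open>N\<^sub>1\<^sup>p N\<^sub>2\<^sup>q\<close> with \<open>p + q\<close>
  maximal extracts \<open>p! q! w\<^sub>p\<^sub>q\<close>.

  For the isomorphism, \<open>u \<otimes> w \<mapsto> u w\<close> is a homomorphism of \<open>U(\<hh>)\<close>-modules, surjective by the first fact.
  Since the products \<open>(d\<^sub>1)\<^sub>i (d\<^sub>2)\<^sub>j\<close> span \<open>U(\<hh>)\<close> (\<open>ffact_products_span\<close>, the easy half of the
  Poincare-Birkhoff-Witt theorem), every tensor is a sum of \<open>(d\<^sub>1)\<^sub>i (d\<^sub>2)\<^sub>j \<otimes> w\<^sub>i\<^sub>j\<close>, and the second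
  fact shows that it vanishes if its image does (\<open>free_module_iso_tensor\<close>).
\<close>

section \<open>Falling factorials of a shifted operator\<close>

text \<open>
  The relation of \<open>P = \<partial>\<^sub>i\<close> and \<open>X = d\<^sub>i\<close>. It says \<open>P f(X) = f(X + 1) P\<close>: on functions of a
  variable \<open>x\<close>, think of the shift by one and of multiplication by \<open>x\<close>, so that \<open>N\<close> below is the forward
  difference and \<open>falling n\<close> is multiplication by \<open>x (x - 1) \<cdots> (x - n + 1)\<close>.
\<close>
locale shift_pair = vector_space scale
  for scale :: "'k::field_char_0 \<Rightarrow> 'm::ab_group_add \<Rightarrow> 'm" +
  fixes P X :: "'m \<Rightarrow> 'm"
  assumes P_linear: "Vector_Spaces.linear scale scale P"
    and X_linear: "Vector_Spaces.linear scale scale X"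
    and P_X: "P (X v) = X (P v) + P v"
begin

sublocale P: Vector_Spaces.linear scale scale P by (rule P_linear)
sublocale X: Vector_Spaces.linear scale scale X by (rule X_linear)

definition N :: "'m \<Rightarrow> 'm" where "N v = P v - v"

primrec falling :: "nat \<Rightarrow> 'm \<Rightarrow> 'm" where
  "falling 0 v = v"
| "falling (Suc n) v = X (falling n v) - scale (of_nat n) (falling n v)"

lemma N_linear: "Vector_Spaces.linear scale scale N"
  by unfold_locales (simp_all add: N_def P.add P.scale scale_right_diff_distrib)

lemma N_pow_linear: "Vector_Spaces.linear scale scale (N ^^ n)"
proof (induction n)
  case 0
  show ?case using linear_id by (simp add: id_def)
next
  case (Suc n)
  show ?case
    using Vector_Spaces.linear_compose[OF Suc N_linear] by (simp only: funpow.simps)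
qed

lemma falling_linear: "Vector_Spaces.linear scale scale (falling n)"
proof unfold_locales
  fix u v show "falling n (u + v) = falling n u + falling n v"
    by (induction n) (simp_all add: X.add scale_right_distrib)
next
  fix c u show "falling n (scale c u) = scale c (falling n u)"
    by (induction n) (simp_all add: X.scale scale_right_diff_distrib mult.commute)
qed

text \<open>
  The discrete analogue of \<open>(x\<^sup>n)' = n x\<^bsup>n-1\<^esup>\<close>. It is the reason for preferring falling factorials to powers
  of \<open>X\<close>, on which \<open>N\<close> acts by a sum over all lower degrees.
\<close>
lemma N_falling_Suc:
  assumes "P w = w"
  shows "N (falling (Suc n) w) = scale (of_nat (Suc n)) (falling n w)"
proof (induction n)
  case 0
  show ?case by (simp add: N_def P_X assms P.diff)
next
  case (Suc n)
  define u u' where "u = falling n w" and "u' = falling (Suc n) w"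
  have X: "X u = u' + scale (of_nat n) u"
    by (simp add: u_def u'_def)
  have P: "P u' = u' + scale (of_nat (Suc n)) u"
    using Suc by (simp add: N_def u_def u'_def algebra_simps)
  have "N (falling (Suc (Suc n)) w) = P (X u' - scale (of_nat (Suc n)) u') - (X u' - scale (of_nat (Suc n)) u')"
    by (simp add: N_def u'_def)
  also have "\<dots> = scale (of_nat (Suc (Suc n))) u'"
    unfolding P.diff P.scale P_X P X.add X.scale X
    by (simp add: scale_right_diff_distrib scale_right_distrib scale_left_distrib distrib_left
        distrib_right scale_left_distrib[of 1 1 u', simplified] del: scale_scale)
  finally show ?case by (simp only: u'_def)
qed

lemma N_pow_falling:
  assumes "P w = w"
  shows "(N ^^ n) (falling n w) = scale (fact n) w"
proof (induction n)
  case (Suc n)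
  interpret Nn: Vector_Spaces.linear scale scale "N ^^ n" by (rule N_pow_linear)
  show ?case
    unfolding funpow_Suc_right o_apply N_falling_Suc[OF assms] Nn.scale Suc by simp
qed simp

lemma N_pow_falling_eq_0:
  assumes "P w = w" "n < m"
  shows "(N ^^ m) (falling n w) = 0"
proof -
  interpret Nk: Vector_Spaces.linear scale scale "N ^^ (m - Suc n)" by (rule N_pow_linear)
  have "N (scale (fact n) w) = 0"
    using assms(1) by (simp add: N_def P.scale)
  moreover have "(N ^^ m) v = (N ^^ (m - Suc n)) (N ((N ^^ n) v))" for v
    using assms(2) funpow_add[of "m - Suc n" "Suc n" N] by simp
  ultimately show ?thesis
    by (simp add: N_pow_falling[OF assms(1)] Nk.zero)
qed

text \<open>
  The Taylor expansion of \<open>v\<close>, built from its leading coefficient down. The invariant subspace \<open>V\<close> makes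
  the lemma usable twice: for the whole module, and then for the second pair of operators on the space of
  vectors fixed by \<open>P\<close>.
\<close>
lemma nilpotent_in_span_falling:
  assumes V: "subspace V" "\<And>u. u \<in> V \<Longrightarrow> P u \<in> V" "\<And>u. u \<in> V \<Longrightarrow> X u \<in> V"
    and "v \<in> V" "(N ^^ n) v = 0"
  shows "v \<in> span {falling i w | i w. w \<in> V \<and> P w = w}"
  using assms(4,5)
proof (induction n arbitrary: v)
  case 0
  then show ?case by (simp add: span_zero)
next
  case (Suc n)
  interpret Nn: Vector_Spaces.linear scale scale "N ^^ n" by (rule N_pow_linear)
  have N: "(N ^^ k) u \<in> V" if "u \<in> V" for k u
    using that by (induction k) (simp_all add: N_def V subspace_diff)
  have falling: "falling k u \<in> V" if "u \<in> V" for k u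
    using that by (induction k) (simp_all add: V subspace_diff subspace_scale)
  \<comment> \<open>The leading coefficient: \<open>N\<^sup>n\<close> multiplies \<open>w\<close> by \<open>n!\<close> in \<open>falling n w\<close>.\<close>
  define w where "w = scale (1 / fact n) ((N ^^ n) v)"
  have "N ((N ^^ n) v) = 0" using Suc.prems(2) by simp
  then have w: "w \<in> V" "P w = w"
    using N[OF Suc.prems(1)] by (auto simp: w_def N_def P.scale V subspace_scale)
  have "(N ^^ n) (v - falling n w) = 0"
    by (simp add: Nn.diff N_pow_falling[OF w(2)]) (simp add: w_def)
  then have "v - falling n w \<in> span {falling i w | i w. w \<in> V \<and> P w = w}"
    using Suc falling w(1) V(1) by (simp add: subspace_diff)
  moreover have "falling n w \<in> span {falling i w | i w. w \<in> V \<and> P w = w}"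
    using w by (blast intro: span_base)
  ultimately show ?case
    using span_add by fastforce
qed

end

locale commuting_shift_pairs = X: shift_pair scale P X + Y: shift_pair scale Q Y
  for scale :: "'k::field_char_0 \<Rightarrow> 'm::ab_group_add \<Rightarrow> 'm" and P X Q Y +
  assumes P_Q: "P (Q v) = Q (P v)" and P_Y: "P (Y v) = Y (P v)" and Q_X: "Q (X v) = X (Q v)"
begin

lemma P_Y_falling: "P w = w \<Longrightarrow> P (Y.falling j w) = Y.falling j w"
  by (induction j) (simp_all add: P_Y X.P.diff X.P.scale)

lemma Y_N_pow_X_falling: "(Y.N ^^ q) (X.falling i v) = X.falling i ((Y.N ^^ q) v)"
proof -
  have N_X: "Y.N (X v) = X (Y.N v)" for v
    by (simp add: Y.N_def Q_X X.X.diff)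
  interpret N: Vector_Spaces.linear scale scale Y.N by (rule Y.N_linear)
  have "Y.N (X.falling i v) = X.falling i (Y.N v)" for v
    by (induction i) (simp_all add: N_X N.diff N.scale)
  then show ?thesis by (induction q) simp_all
qed

text \<open>
  Expand \<open>v\<close> with respect to \<open>X\<close>. The coefficients lie in the fixed space of \<open>P\<close>, which \<open>Q\<close> and \<open>Y\<close>
  preserve, and can therefore be expanded there with respect to \<open>Y\<close>; the coefficients are then fixed by
  both \<open>P\<close> and \<open>Q\<close>.
\<close>
lemma nilpotent_in_span_falling2:
  assumes "\<And>v. \<exists>n. (X.N ^^ n) v = 0" "\<And>v. \<exists>n. (Y.N ^^ n) v = 0"
  shows "v \<in> X.span {X.falling i (Y.falling j w) | i j w. P w = w \<and> Q w = w}" (is "_ \<in> ?S")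
proof -
  obtain n where "(X.N ^^ n) v = 0" using assms(1) by blast
  then have "v \<in> X.span {X.falling i u | i u. u \<in> UNIV \<and> P u = u}"
    by (intro X.nilpotent_in_span_falling) simp_all
  moreover have "{X.falling i u | i u. u \<in> UNIV \<and> P u = u} \<subseteq> ?S"
  proof clarify
    fix i u assume u: "P u = u"
    interpret f: Vector_Spaces.linear scale scale "X.falling i" by (rule X.falling_linear)
    obtain m where "(Y.N ^^ m) u = 0" using assms(2) by blast
    moreover have "X.subspace {u. P u = u}"
      by (rule X.subspaceI) (simp_all add: X.P.zero X.P.add X.P.scale)
    ultimately have "u \<in> X.span {Y.falling j w | j w. w \<in> {u. P u = u} \<and> Q w = w}"
      using u by (intro Y.nilpotent_in_span_falling) (simp_all add: P_Q P_Y)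
    then have "X.falling i u \<in> X.falling i ` X.span {Y.falling j w | j w. w \<in> {u. P u = u} \<and> Q w = w}"
      by (rule imageI)
    also have "\<dots> = X.span (X.falling i ` {Y.falling j w | j w. w \<in> {u. P u = u} \<and> Q w = w})"
      by (rule f.span_image[symmetric])
    also have "\<dots> \<subseteq> ?S"
      by (intro X.span_mono) blast
    finally show "X.falling i u \<in> ?S" .
  qed
  ultimately show ?thesis
    using X.span_minimal[OF _ X.subspace_span] by blast
qed

text \<open>
  Among the indices with nonzero coefficient, let \<open>(p, q)\<close> have maximal total degree. Any other such index
  is smaller than \<open>(p, q)\<close> in one of its two components, so that \<open>N\<^sub>X\<^sup>p N\<^sub>Y\<^sup>q\<close> kills all terms but one
  and leaves \<open>p! q!\<close> times its coefficient.
\<close>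
lemma falling2_independent:
  assumes J: "finite J" and w: "\<And>k. P (w k) = w k" "\<And>k. Q (w k) = w k"
    and sum: "(\<Sum>k\<in>J. X.falling (fst k) (Y.falling (snd k) (w k))) = 0"
    and "k \<in> J"
  shows "w k = 0"
proof (rule ccontr)
  assume "w k \<noteq> 0"
  define J' where "J' = {k\<in>J. w k \<noteq> 0}"
  have J': "finite J'" "k \<in> J'" using J \<open>k \<in> J\<close> \<open>w k \<noteq> 0\<close> by (simp_all add: J'_def)
  define m where "m = Max ((\<lambda>k. fst k + snd k) ` J')"
  have "m \<in> (\<lambda>k. fst k + snd k) ` J'"
    unfolding m_def using J' by (intro Max_in) auto
  then obtain p q where pq: "(p, q) \<in> J'" "m = p + q" by auto
  have le: "fst k + snd k \<le> p + q" if "k \<in> J'" for k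
    using that J' unfolding pq(2)[symmetric] m_def by (intro Max_ge) auto
  interpret Np: Vector_Spaces.linear scale scale "X.N ^^ p" by (rule X.N_pow_linear)
  interpret Nq: Vector_Spaces.linear scale scale "Y.N ^^ q" by (rule Y.N_pow_linear)
  let ?t = "\<lambda>k. X.falling (fst k) (Y.falling (snd k) (w k))"
  let ?N = "\<lambda>v. (X.N ^^ p) ((Y.N ^^ q) v)"
  have fl0: "X.falling i 0 = 0" "Y.falling i 0 = 0" for i
    using module_hom.zero[OF module_hom_iff_linear[THEN iffD2, OF X.falling_linear]]
      module_hom.zero[OF module_hom_iff_linear[THEN iffD2, OF Y.falling_linear]] by auto
  have pow_P: "P v = v \<Longrightarrow> P ((Y.N ^^ n) v) = (Y.N ^^ n) v" for n v
    by (induction n) (simp_all add: Y.N_def P_Q X.P.diff)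
  have kill: "?N (?t k) = 0" if "k \<in> J - {(p, q)}" for k
  proof (cases "k \<in> J'")
    case True
    obtain i j where k: "k = (i, j)" by (cases k)
    have "i < p \<or> j < q" using le[OF True] that k by auto
    then show ?thesis
    proof
      assume "j < q"
      then show ?thesis
        using Y.N_pow_falling_eq_0[OF w(2)] by (simp add: k Y_N_pow_X_falling fl0 Np.zero)
    next
      assume "i < p"
      moreover have "P ((Y.N ^^ q) (Y.falling j (w k))) = (Y.N ^^ q) (Y.falling j (w k))"
        by (intro pow_P P_Y_falling w)
      ultimately show ?thesis
        using X.N_pow_falling_eq_0 by (simp add: k Y_N_pow_X_falling)
    qed
  next
    case False
    then have "w k = 0" using that by (simp add: J'_def)
    then show ?thesis by (simp add: fl0 Np.zero Nq.zero)
  qed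
  have "0 = ?N (\<Sum>k\<in>J. ?t k)" using sum by (simp add: Np.zero Nq.zero)
  also have "\<dots> = (\<Sum>k\<in>J. ?N (?t k))" by (simp only: Np.sum Nq.sum)
  also have "\<dots> = ?N (?t (p, q))"
    using kill J pq(1) by (subst sum.remove[of _ "(p, q)"]) (simp_all add: J'_def)
  also have "\<dots> = scale (fact p * fact q) (w (p, q))"
    by (simp add: Y_N_pow_X_falling Y.N_pow_falling w X.N_pow_falling X.P.scale)
  finally show False using pq(1) by (simp add: J'_def)
qed

end

section \<open>Ordered products span the enveloping algebra\<close>

text \<open>
  The falling factorial in a ring that need not be commutative, here the free algebra.
\<close>
primrec ffact :: "'a::ring_1 \<Rightarrow> nat \<Rightarrow> 'a" where
  "ffact x 0 = 1"
| "ffact x (Suc n) = (x - of_nat n) * ffact x n"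

lemma ffact_mult_left: "x * ffact x n = ffact x (Suc n) + of_nat n * ffact x n"
  by (simp add: algebra_simps)

lemma scalar_of_nat: "(of_nat n :: 'g word \<Rightarrow>\<^sub>0 complex) = scalar (of_nat n)"
  by (simp add: scalar_def)

lemma scalar_mult: "scalar c * f = pm_scale c f"
  by (induction f rule: poly_mapping_keys_induct[OF subset_UNIV])
    (simp_all add: scalar_def mult_single distrib_left pm.scale_right_distrib)

lemma mult_scalar: "f * scalar c = pm_scale c f"
  by (induction f rule: poly_mapping_keys_induct[OF subset_UNIV])
    (simp_all add: scalar_def mult_single distrib_right pm.scale_right_distrib mult.commute)

lemma pm_scale_mult_left: "pm_scale c f * g = pm_scale c (f * g)"
  for f g :: "'g word \<Rightarrow>\<^sub>0 complex"
  by (simp flip: scalar_mult add: mult.assoc)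

lemma pm_scale_mult_right: "f * pm_scale c g = pm_scale c (f * g)"
  for f g :: "'g word \<Rightarrow>\<^sub>0 complex"
  by (simp flip: mult_scalar add: mult.assoc)

lemma free_algebra_sel [simp]:
  "mult (free_algebra L) = (*)" "one (free_algebra L) = 1"
  "zero (free_algebra L) = 0" "add (free_algebra L) = (+)"
  by (simp_all add: free_algebra_def)

lemma letter_closed: "x \<in> L \<Longrightarrow> letter x \<in> carrier (free_algebra L)"
  by (simp add: letter_def free_algebra_def)

lemma scalar_closed: "scalar c \<in> carrier (free_algebra L)"
  by (simp add: scalar_def free_algebra_def zero_word_def)

lemma free_algebra_closed:
  assumes "f \<in> carrier (free_algebra L)" "g \<in> carrier (free_algebra L)"
  shows "f + g \<in> carrier (free_algebra L)" "f * g \<in> carrier (free_algebra L)"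
    "f - g \<in> carrier (free_algebra L)"
proof -
  interpret ring "free_algebra L" by (rule ring_free_algebra)
  show "f + g \<in> carrier (free_algebra L)" "f * g \<in> carrier (free_algebra L)"
    using a_closed[OF assms] m_closed[OF assms] by simp_all
  show "f - g \<in> carrier (free_algebra L)"
    using assms keys_diff[of f g] by (auto simp: free_algebra_def)
qed

lemma pm_scale_closed:
  "f \<in> carrier (free_algebra L) \<Longrightarrow> pm_scale c f \<in> carrier (free_algebra L)"
  using free_algebra_closed(2)[OF scalar_closed] by (simp add: scalar_mult)

lemma of_nat_closed: "of_nat n \<in> carrier (free_algebra L)"
  by (simp add: scalar_of_nat scalar_closed)

lemma ffact_closed:
  "f \<in> carrier (free_algebra L) \<Longrightarrow> ffact f n \<in> carrier (free_algebra L)"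
proof (induction n)
  case 0
  show ?case using ring.ring_simprules(6)[OF ring_free_algebra[of L]] by simp
next
  case (Suc n)
  then show ?case by (simp add: free_algebra_closed scalar_of_nat scalar_closed)
qed

text \<open>
  The closure conditions under which the ideal of the enveloping algebra lies in the free algebra on \<open>L\<close>.
  The enveloping algebra is handled through representatives: calculations take place in the type of the
  free algebra, an instance of \<^class>\<open>ring_1\<close>, modulo the ideal \<open>I\<close>.
\<close>
locale lie_subalgebra =
  fixes gscale :: "complex \<Rightarrow> 'g::ab_group_add \<Rightarrow> 'g" and br :: "'g \<Rightarrow> 'g \<Rightarrow> 'g" and L :: "'g set"
  assumes L_add: "x \<in> L \<Longrightarrow> y \<in> L \<Longrightarrow> x + y \<in> L"
    and L_scale: "x \<in> L \<Longrightarrow> gscale c x \<in> L"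
    and L_bracket: "x \<in> L \<Longrightarrow> y \<in> L \<Longrightarrow> br x y \<in> L"
begin

abbreviation "F \<equiv> free_algebra L"
abbreviation "I \<equiv> env_ideal gscale br L"
abbreviation "U \<equiv> envelope gscale br L"
abbreviation coset where "coset f \<equiv> I +>\<^bsub>F\<^esub> f"

lemma env_relations_closed: "env_relations gscale br L \<subseteq> carrier F"
  by (auto simp: env_relations_def intro!: free_algebra_closed letter_closed scalar_closed L_add L_scale L_bracket)

lemma ideal_I: "ideal I F"
  unfolding env_ideal_def
  by (rule ring.genideal_ideal[OF ring_free_algebra env_relations_closed])

sublocale I: ideal I F by (rule ideal_I)

lemma relation_in_I: "f \<in> env_relations gscale br L \<Longrightarrow> f \<in> I"
  unfolding env_ideal_def
  using ring.genideal_self[OF ring_free_algebra env_relations_closed] by blast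

lemma I_closed:
  "0 \<in> I" "f \<in> I \<Longrightarrow> g \<in> I \<Longrightarrow> f + g \<in> I" "f \<in> I \<Longrightarrow> pm_scale c f \<in> I"
  "f \<in> I \<Longrightarrow> h \<in> carrier F \<Longrightarrow> h * f \<in> I" "f \<in> I \<Longrightarrow> h \<in> carrier F \<Longrightarrow> f * h \<in> I"
  using additive_subgroup.zero_closed[OF I.is_additive_subgroup]
    additive_subgroup.a_closed[OF I.is_additive_subgroup, of f g] I.I_l_closed[of f "scalar c"] I.I_l_closed[of f h]
    I.I_r_closed[of f h]
  by (simp_all add: scalar_closed scalar_mult)

lemma I_carrier: "f \<in> I \<Longrightarrow> f \<in> carrier F"
  by (rule I.Icarr)

lemma I_diff: "f \<in> I \<Longrightarrow> g \<in> I \<Longrightarrow> f - g \<in> I"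
  using I_closed(2)[of f "pm_scale (-1) g"] I_closed(3)[of g "-1"] by simp

lemma I_uminus: "f \<in> I \<Longrightarrow> - f \<in> I"
  using I_closed(3)[of f "-1"] by simp

lemma letter_add_in_I:
  assumes "x \<in> L" "y \<in> L"
  shows "letter (x + y) - letter x - letter y \<in> I"
  by (rule relation_in_I) (unfold env_relations_def, use assms in blast)

lemma letter_scale_in_I:
  assumes "x \<in> L"
  shows "letter (gscale c x) - pm_scale c (letter x) \<in> I"
  by (rule relation_in_I) (unfold env_relations_def scalar_mult[symmetric], use assms in blast)

lemma letter_bracket_in_I:
  assumes "x \<in> L" "y \<in> L"
  shows "letter x * letter y - letter y * letter x - letter (br x y) \<in> I"
  by (rule relation_in_I) (unfold env_relations_def, use assms in blast)

text \<open>
  The bracket relation gives this up to the letter \<open>0\<close>, which is a generator of the free algebra and not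
  its zero. It lies in the ideal by additivity, because \<open>0 + 0 = 0\<close>.
\<close>
lemma letter_commute_in_I:
  assumes "x \<in> L" "y \<in> L" "br x y = 0"
  shows "letter y * letter x - letter x * letter y \<in> I"
proof -
  have "0 \<in> L" using L_bracket[OF assms(1,2)] assms(3) by simp
  then have "letter 0 \<in> I"
    using I_uminus[OF letter_add_in_I[of 0 0]] by simp
  then have "letter 0 + (letter x * letter y - letter y * letter x - letter (br x y)) \<in> I"
    by (intro I_closed(2) letter_bracket_in_I assms)
  then have "- (letter x * letter y - letter y * letter x) \<in> I"
    unfolding assms(3) by (intro I_uminus) simp
  then show ?thesis by simp
qed

lemma ffact_commute_in_I:
  assumes "x \<in> L" "y \<in> L" "br x y = 0"
  shows "letter y * ffact (letter x) n - ffact (letter x) n * letter y \<in> I"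
proof (induction n)
  case 0
  show ?case by (simp add: I_closed)
next
  case (Suc n)
  let ?X = "letter x" and ?Y = "letter y" and ?f = "ffact (letter x) n"
  have "?Y * ffact ?X (Suc n) - ffact ?X (Suc n) * ?Y =
      (?Y * ?X - ?X * ?Y) * ?f + (?X - of_nat n) * (?Y * ?f - ?f * ?Y)"
  proof -
    have "of_nat n * (?Y * ?f) = ?Y * (of_nat n * ?f)"
      by (metis mult.assoc mult_of_nat_commute)
    then show ?thesis by (simp add: algebra_simps)
  qed
  also have "\<dots> \<in> I"
    by (intro I_closed(2) I_closed(4)[OF Suc] I_closed(5)[OF letter_commute_in_I[OF assms]]
        ffact_closed letter_closed free_algebra_closed(3) assms of_nat_closed)
  finally show ?case .
qed

text \<open>
  The span of \<open>I\<close> and the ordered products contains \<open>1\<close>, and it is closed under left multiplication by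
  \<open>x\<close>, by the recursion for falling factorials, and by \<open>y\<close>, since \<open>y\<close> can be moved past the falling
  factorials of \<open>x\<close> modulo \<open>I\<close>. Every letter is a combination of \<open>x\<close> and \<open>y\<close> modulo \<open>I\<close>, so the span contains all words.
\<close>
lemma ffact_products_span:
  assumes "x \<in> L" "y \<in> L" "br x y = 0"
    and L_span: "\<And>z. z \<in> L \<Longrightarrow> \<exists>a b. z = gscale a x + gscale b y"
  shows "carrier F \<subseteq> pm.span (I \<union> range (\<lambda>(i, j). ffact (letter x) i * ffact (letter y) j))"
proof -
  define e where "e i j = ffact (letter x) i * ffact (letter y) j" for i j
  define S where "S = pm.span (I \<union> range (\<lambda>(i, j). e i j))"
  have I_S: "f \<in> S" if "f \<in> I" for f
    using that by (simp add: S_def pm.span_base)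
  have e_S: "e i j \<in> S" for i j
    unfolding S_def by (intro pm.span_base UnI2 image_eqI[of _ _ "(i, j)"]) simp_all
  have S: "f \<in> S \<Longrightarrow> g \<in> S \<Longrightarrow> f + g \<in> S" "f \<in> S \<Longrightarrow> pm_scale c f \<in> S" for f g c
    by (simp_all add: S_def pm.span_add pm.span_scale)
  have mult_S: "h * f \<in> S" if "f \<in> S" "h \<in> carrier F" "\<And>i j. h * e i j \<in> S" for h f
    using that(1) unfolding S_def
  proof (induction rule: pm.span_induct_alt)
    case base
    show ?case by (simp add: pm.span_zero)
  next
    case (step c f g)
    have "h * f \<in> S"
      using step.hyps that I_closed(4) I_S by auto
    with step.IH show ?case
      by (simp add: distrib_left pm_scale_mult_right S(1,2) flip: S_def)
  qed
  have of_nat: "of_nat n * f = pm_scale (of_nat n) f" for n and f :: "'g word \<Rightarrow>\<^sub>0 complex"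
    by (simp add: scalar_of_nat scalar_mult)
  have x_S: "letter x * f \<in> S" if "f \<in> S" for f
  proof (rule mult_S[OF that letter_closed[OF assms(1)]])
    fix i j
    have "letter x * e i j = e (Suc i) j + pm_scale (of_nat i) (e i j)"
      unfolding e_def mult.assoc[symmetric] ffact_mult_left
      by (simp add: distrib_right of_nat pm_scale_mult_left)
    then show "letter x * e i j \<in> S" by (simp add: S e_S)
  qed
  have y_S: "letter y * f \<in> S" if "f \<in> S" for f
  proof (rule mult_S[OF that letter_closed[OF assms(2)]])
    fix i j
    let ?c = "letter y * ffact (letter x) i - ffact (letter x) i * letter y"
    have "letter y * e i j = ?c * ffact (letter y) j + ffact (letter x) i * (letter y * ffact (letter y) j)"
      by (simp add: e_def algebra_simps)
    also have "ffact (letter x) i * (letter y * ffact (letter y) j) = e i (Suc j) + pm_scale (of_nat j) (e i j)"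
      unfolding ffact_mult_left e_def by (simp only: distrib_left of_nat pm_scale_mult_right)
    also have "?c * ffact (letter y) j \<in> I"
      using assms by (intro I_closed(5) ffact_commute_in_I ffact_closed letter_closed)
    ultimately show "letter y * e i j \<in> S" by (simp add: S e_S I_S)
  qed
  have word: "Poly_Mapping.single (Word zs) 1 \<in> S" if "set zs \<subseteq> L" for zs
    using that
  proof (induction zs)
    case Nil
    show ?case using e_S[of 0 0] by (simp add: e_def flip: zero_word_def)
  next
    case (Cons z zs)
    let ?f = "Poly_Mapping.single (Word zs) 1 :: 'g word \<Rightarrow>\<^sub>0 complex"
    obtain a b where z: "z = gscale a x + gscale b y"
      using L_span[of z] Cons.prems by auto
    \<comment> \<open>This is \<open>letter z - a (letter x) - b (letter y)\<close>, arranged as a sum of linearity relations.\<close>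
    let ?g = "letter z - letter (gscale a x) - letter (gscale b y)
      + (letter (gscale a x) - pm_scale a (letter x)) + (letter (gscale b y) - pm_scale b (letter y))"
    have "?g \<in> I"
      unfolding z using assms by (intro I_closed(2) letter_add_in_I letter_scale_in_I L_scale)
    then have "?g * ?f \<in> I"
      using Cons.prems by (intro I_closed(5)) (simp_all add: free_algebra_def)
    moreover have "Poly_Mapping.single (Word (z # zs)) 1 =
        ?g * ?f + pm_scale a (letter x * ?f) + pm_scale b (letter y * ?f)"
    proof -
      have "Poly_Mapping.single (Word (z # zs)) 1 = letter z * ?f"
        by (simp add: letter_def mult_single plus_word_def)
      also have "letter z = ?g + pm_scale a (letter x) + pm_scale b (letter y)"
        by (simp add: algebra_simps)
      finally show ?thesis by (simp only: distrib_right pm_scale_mult_left)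
    qed
    ultimately show ?case
      using Cons by (simp add: S x_S y_S I_S)
  qed
  have "f \<in> S" if "f \<in> carrier F" for f
  proof -
    have "Poly_Mapping.keys f \<subseteq> {w. set (letters w) \<subseteq> L}"
      using that by (auto simp: free_algebra_def)
    then show ?thesis
    proof (induction f rule: poly_mapping_keys_induct)
      case zero
      show ?case by (simp add: I_S I_closed)
    next
      case (single w c)
      then show ?case
        using S(2)[OF word, of "letters w" c] by simp
    next
      case (add f g)
      then show ?case by (rule S)
    qed
  qed
  then show ?thesis by (auto simp: S_def e_def)
qed

lemma coset_eq: "f - g \<in> I \<Longrightarrow> coset f = coset g"
proof -
  assume fg: "f - g \<in> I"
  have c: "coset h = {r + h | r. r \<in> I}" for h
    by (auto simp: a_r_coset_def r_coset_def free_algebra_def)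
  have "r + f = (r + (f - g)) + g \<and> r + g = (r - (f - g)) + f" for r by simp
  then show ?thesis
    unfolding c using I_closed(2)[OF _ fg] I_diff[OF _ fg] by blast
qed

lemma envelope_carrier: "carrier U = coset ` carrier F"
  by (auto simp: envelope_def Let_def FactRing_def A_RCOSETS_def RCOSETS_def a_r_coset_def)

lemma envelope_mult:
  "f \<in> carrier F \<Longrightarrow> g \<in> carrier F \<Longrightarrow> coset f \<otimes>\<^bsub>U\<^esub> coset g = coset (f * g)"
  using I.rcoset_mult_add[of f g] by (simp add: envelope_def Let_def FactRing_def)

lemma envelope_add:
  "f \<in> carrier F \<Longrightarrow> g \<in> carrier F \<Longrightarrow> coset f \<oplus>\<^bsub>U\<^esub> coset g = coset (f + g)"
  using abelian_subgroup.a_rcos_sum[OF abelian_subgroupI3[OF I.is_additive_subgroup I.is_abelian_group], of f g]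
  by (simp add: envelope_def Let_def FactRing_def)

lemma envelope_smult:
  "f \<in> carrier F \<Longrightarrow> c \<odot>\<^bsub>U\<^esub> coset f = coset (pm_scale c f)"
  using I.rcoset_mult_add[of "scalar c" f]
  by (simp add: envelope_def Let_def FactRing_def scalar_closed scalar_mult)

lemma ring_envelope: "ring U"
proof -
  interpret Q: ring "F Quot I" by (rule I.quotient_is_ring)
  have U: "carrier U = carrier (F Quot I)" "mult U = mult (F Quot I)" "one U = one (F Quot I)"
    "zero U = zero (F Quot I)" "add U = add (F Quot I)"
    by (simp_all add: envelope_def Let_def)
  show ?thesis
  proof (rule ringI)
    show "abelian_group U"
      by (rule abelian_groupI) (simp_all add: U Q.a_assoc, simp_all add: Q.a_comm Q.add.l_inv_ex)
    show "monoid U"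
      by (rule monoidI) (auto simp: U Q.m_assoc)
  qed (auto simp: U Q.l_distr Q.r_distr)
qed

end

section \<open>Tensor products and free modules\<close>

lemma keys_subspace: "pm.subspace {f. Poly_Mapping.keys f \<subseteq> S}"
proof (rule pm.subspaceI)
  fix f g :: "'a \<Rightarrow>\<^sub>0 complex"
  assume "f \<in> {f. Poly_Mapping.keys f \<subseteq> S}" "g \<in> {f. Poly_Mapping.keys f \<subseteq> S}"
  then show "f + g \<in> {f. Poly_Mapping.keys f \<subseteq> S}"
    using keys_add[of f g] by blast
qed (auto simp: in_keys_iff)

definition lin_ext ::
    "(complex \<Rightarrow> 'm::ab_group_add \<Rightarrow> 'm) \<Rightarrow> ('k \<Rightarrow> 'm) \<Rightarrow> ('k \<Rightarrow>\<^sub>0 complex) \<Rightarrow> 'm"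
  where "lin_ext scale h f = (\<Sum>k\<in>Poly_Mapping.keys f. scale (Poly_Mapping.lookup f k) (h k))"

lemma lin_ext_superset:
  assumes "vector_space scale" "finite S" "Poly_Mapping.keys f \<subseteq> S"
  shows "lin_ext scale h f = (\<Sum>k\<in>S. scale (Poly_Mapping.lookup f k) (h k))"
proof -
  interpret vector_space scale by fact
  show ?thesis
    unfolding lin_ext_def using assms(2,3) by (intro sum.mono_neutral_left) (auto simp: in_keys_iff)
qed

lemma lin_ext_linear:
  assumes "vector_space scale"
  shows "Vector_Spaces.linear pm_scale scale (lin_ext scale h)"
proof -
  interpret vector_space scale by fact
  show ?thesis
  proof unfold_locales
    fix f g
    show "lin_ext scale h (f + g) = lin_ext scale h f + lin_ext scale h g"
      by (simp add: lin_ext_superset[OF assms, of "Poly_Mapping.keys f \<union> Poly_Mapping.keys g"]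
          keys_add lookup_add scale_left_distrib sum.distrib)
  next
    fix c f
    show "lin_ext scale h (pm_scale c f) = scale c (lin_ext scale h f)"
      by (subst lin_ext_superset[OF assms, of "Poly_Mapping.keys f"])
        (auto simp: lin_ext_def in_keys_iff scale_sum_right)
  qed
qed

locale closed_lie_module = lie_module scale gscale br L act + lie_subalgebra gscale br L
  for scale :: "complex \<Rightarrow> 'm::ab_group_add \<Rightarrow> 'm"
    and gscale :: "complex \<Rightarrow> 'g::ab_group_add \<Rightarrow> 'g" and br L act
begin

lemma env_act_coset_eq: "env_act scale act (coset f) v = free_act scale act f v"
  by (rule env_act_coset[OF L_add L_scale L_bracket])

lemma free_act_pm_scale: "free_act scale act (pm_scale c f) v = scale c (free_act scale act f v)"
  by (subst free_act_superset[of "Poly_Mapping.keys f"])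
    (auto simp: free_act_def in_keys_iff scale_sum_right)

text \<open>The map \<open>u \<otimes> w \<mapsto> u w\<close> on the level of representatives.\<close>
definition eval :: "((('g word \<Rightarrow>\<^sub>0 complex) set \<times> 'm) \<Rightarrow>\<^sub>0 complex) \<Rightarrow> 'm"
  where "eval = lin_ext scale (\<lambda>(u, w). env_act scale act u w)"

sublocale eval: Vector_Spaces.linear pm_scale scale eval
  unfolding eval_def by (rule lin_ext_linear[OF vector_space_axioms])

lemma eval_pure: "eval (pure u w) = env_act scale act u w"
  by (simp add: eval_def lin_ext_def)

lemma free_act_ffact_letter:
  assumes "x \<in> L" "shift_pair scale P (act x)"
  shows "free_act scale act (ffact (letter x) n) v = shift_pair.falling scale (act x) n v"
proof -
  interpret S: shift_pair scale P "act x" by fact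
  have of_nat: "free_act scale act (of_nat n) v = scale (of_nat n) v" for n v
    by (simp add: scalar_of_nat scalar_def zero_word_def)
  have letter: "free_act scale act (letter x) v = act x v" for v
    by (simp add: letter_def)
  show ?thesis
  proof (induction n)
    case 0
    show ?case using of_nat[of 1] by simp
  next
    case (Suc n)
    then show ?case
      by (simp add: free_act_mult free_algebra_closed letter_closed of_nat_closed assms(1)
          free_act_diff letter of_nat)
  qed
qed

context
  fixes W :: "'m set"
  assumes W: "subspace W"
begin

abbreviation (input) "Wm \<equiv> subspace_module scale W"
abbreviation (input) "R \<equiv> tensor_relations U Wm"

lemma Wm_sel: "carrier Wm = W" "add Wm = (+)" "smult Wm = scale"
  by (simp_all add: subspace_module_def)

lemma R_subspace: "pm.subspace R"
  by (simp add: tensor_relations_def)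

lemmas R_closed = pm.subspace_0[OF R_subspace] pm.subspace_add[OF R_subspace]
  pm.subspace_diff[OF R_subspace] pm.subspace_scale[OF R_subspace] pm.subspace_sum[OF R_subspace]

lemma R_bilinear:
  assumes "f \<in> carrier F" "w \<in> W"
  shows "g \<in> carrier F \<Longrightarrow> pure (coset (f + g)) w - pure (coset f) w - pure (coset g) w \<in> R"
    and "w' \<in> W \<Longrightarrow> pure (coset f) (w + w') - pure (coset f) w - pure (coset f) w' \<in> R"
    and "pure (coset (pm_scale c f)) w - pm_scale c (pure (coset f) w) \<in> R"
    and "pure (coset f) (scale c w) - pm_scale c (pure (coset f) w) \<in> R"
proof -
  have cf: "coset f \<in> carrier U" using assms by (simp add: envelope_carrier)
  show "g \<in> carrier F \<Longrightarrow> pure (coset (f + g)) w - pure (coset f) w - pure (coset g) w \<in> R"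
  proof -
    assume g: "g \<in> carrier F"
    then have "coset g \<in> carrier U" by (simp add: envelope_carrier)
    then show ?thesis
      unfolding tensor_relations_def envelope_add[OF assms(1) g, symmetric] using cf assms(2)
      by (intro pm.span_base) (auto simp only: Wm_sel)
  qed
  show "w' \<in> W \<Longrightarrow> pure (coset f) (w + w') - pure (coset f) w - pure (coset f) w' \<in> R"
    unfolding tensor_relations_def Wm_sel using cf assms(2)
    by (intro pm.span_base) blast
  show "pure (coset (pm_scale c f)) w - pm_scale c (pure (coset f) w) \<in> R"
    unfolding tensor_relations_def envelope_smult[OF assms(1), symmetric] Wm_sel using cf assms(2)
    by (intro pm.span_base) blast
  show "pure (coset f) (scale c w) - pm_scale c (pure (coset f) w) \<in> R"
    unfolding tensor_relations_def Wm_sel using cf assms(2)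
    by (intro pm.span_base) blast
qed

lemma R_pure_zero: "f \<in> carrier F \<Longrightarrow> pure (coset f) 0 \<in> R"
  using R_bilinear(4)[of f 0 0] W by (simp add: subspace_0)

text \<open>
  All four families of tensor relations consist of formal combinations of pure tensors with entries in
  \<open>U\<close> and \<open>W\<close>, and \<open>(u, w) \<mapsto> u w\<close> is bilinear; so \<open>eval\<close> descends to the tensor product.
\<close>
lemma R_properties:
  "R \<subseteq> {f. Poly_Mapping.keys f \<subseteq> carrier U \<times> W} \<inter> {f. eval f = 0}"
  (is "_ \<subseteq> ?K \<inter> ?Z")
proof -
  interpret U: ring U by (rule ring_envelope)
  have KZ: "pm.subspace (?K \<inter> ?Z)"
    by (intro pm.subspace_inter keys_subspace eval.subspace_kernel)
  have K: "pure u w \<in> ?K" if "u \<in> carrier U" "w \<in> W" for u w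
    using that by simp
  note K_closed = pm.subspace_diff[OF keys_subspace] pm.subspace_scale[OF keys_subspace]
  have env_act_right: "env_act scale act u (w + w') = env_act scale act u w + env_act scale act u w'"
    "env_act scale act u (scale c w) = scale c (env_act scale act u w)"
    if u: "u \<in> carrier U" for u w w' c
  proof -
    obtain f where f: "f \<in> carrier F" "u = coset f" using u by (auto simp: envelope_carrier)
    interpret f: Vector_Spaces.linear scale scale "free_act scale act f"
      by (rule free_act_letters_linear[OF f(1)])
    show "env_act scale act u (w + w') = env_act scale act u w + env_act scale act u w'"
      "env_act scale act u (scale c w) = scale c (env_act scale act u w)"
      by (simp_all add: f env_act_coset_eq f.add f.scale)
  qed
  have smult: "c \<odot>\<^bsub>U\<^esub> u \<in> carrier U" 
      "env_act scale act (c \<odot>\<^bsub>U\<^esub> u) w = scale c (env_act scale act u w)"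
    if u: "u \<in> carrier U" for u w c
    using u by (auto simp: envelope_carrier envelope_smult env_act_coset_eq free_act_pm_scale pm_scale_closed)
  have add: "env_act scale act (u \<oplus>\<^bsub>U\<^esub> u') w = env_act scale act u w + env_act scale act u' w"
    if "u \<in> carrier U" "u' \<in> carrier U" for u u' w
    using that by (auto simp: envelope_carrier envelope_add env_act_coset_eq free_act_add)
  have g1: "pure (u \<oplus>\<^bsub>U\<^esub> u') w - pure u w - pure u' w \<in> ?K \<inter> ?Z"
    if "u \<in> carrier U" "u' \<in> carrier U" "w \<in> W" for u u' w
    using that by (intro IntI K_closed K U.a_closed) (simp_all add: eval.diff eval_pure add)
  have g2: "pure u (w + w') - pure u w - pure u w' \<in> ?K \<inter> ?Z"
    if "u \<in> carrier U" "w \<in> W" "w' \<in> W" for u w w'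
    using that by (intro IntI K_closed K subspace_add[OF W]) (simp_all add: eval.diff eval_pure env_act_right)
  have g3: "pure (c \<odot>\<^bsub>U\<^esub> u) w - pm_scale c (pure u w) \<in> ?K \<inter> ?Z"
    if "u \<in> carrier U" "w \<in> W" for c u w
    using that by (intro IntI K_closed K smult)
      (simp_all only: mem_Collect_eq eval.diff eval.scale eval_pure smult diff_self)
  have g4: "pure u (scale c w) - pm_scale c (pure u w) \<in> ?K \<inter> ?Z"
    if "u \<in> carrier U" "w \<in> W" for c u w
    using that by (intro IntI K_closed K subspace_scale[OF W])
      (simp_all only: mem_Collect_eq eval.diff eval.scale eval_pure env_act_right diff_self)
  show ?thesis
    unfolding tensor_relations_def
  proof (rule pm.span_minimal[OF _ KZ], intro Un_least subsetI, goal_cases)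
    case 1 then show ?case unfolding Wm_sel using g1 by blast
  next
    case 2 then show ?case unfolding Wm_sel using g2 by blast
  next
    case 3 then show ?case unfolding Wm_sel using g3 by blast
  next
    case 4 then show ?case unfolding Wm_sel using g4 by blast
  qed
qed

lemma R_keys: "f \<in> R \<Longrightarrow> Poly_Mapping.keys f \<subseteq> carrier U \<times> W"
  and R_eval: "f \<in> R \<Longrightarrow> eval f = 0"
  using R_properties by auto

text \<open>
  For fixed \<open>w\<close>, the class of \<open>h \<otimes> w\<close> depends linearly on \<open>h\<close> and only on \<open>h\<close> modulo \<open>I\<close>; so it suffices
  to consider the \<open>h\<close> in a set that spans together with \<open>I\<close>.
\<close>
lemma tensor_spanned:
  assumes e: "\<And>i. e i \<in> carrier F"
    and e_span: "carrier F \<subseteq> pm.span (I \<union> range e)"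
    and f: "Poly_Mapping.keys f \<subseteq> carrier U \<times> W"
  shows "f \<in> pm.span (R \<union> {pure (coset (e i)) w | i w. w \<in> W})" (is "f \<in> ?E")
proof -
  have R: "g \<in> ?E" if "g \<in> R" for g
    using that by (simp add: pm.span_base)
  have pure: "h \<in> carrier F \<and> pure (coset h) w \<in> ?E" if "h \<in> carrier F" and w: "w \<in> W" for h w
  proof -
    have "h \<in> pm.span (I \<union> range e)" using e_span that(1) by blast
    then show ?thesis
    proof (induction rule: pm.span_induct_alt)
      case base
      have 0: "(0 :: 'g word \<Rightarrow>\<^sub>0 complex) \<in> carrier F" by (simp add: free_algebra_def)
      have "pure (coset 0) w \<in> R" using R_bilinear(3)[OF 0 w, of 0] by simp
      then show ?case using 0 R by (intro conjI)
    next
      case (step c x y)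
      have x: "x \<in> carrier F" using step.hyps(1) I_carrier e by (elim UnE) auto
      have cx: "pm_scale c x \<in> carrier F" using x by (rule pm_scale_closed)
      have "pure (coset x) w \<in> ?E"
      proof (cases "x \<in> I")
        case True
        have "pure (coset 0) w \<in> R" using R_bilinear(3)[OF x w, of 0] by simp
        then show ?thesis using coset_eq[of x 0] True R by simp
      next
        case False
        then obtain i where "x = e i" using step.hyps(1) by blast
        then show ?thesis using w by (intro pm.span_base UnI2) blast
      qed
      then have "(pure (coset (pm_scale c x + y)) w - pure (coset (pm_scale c x)) w - pure (coset y) w)
          + (pure (coset (pm_scale c x)) w - pm_scale c (pure (coset x) w))
          + pm_scale c (pure (coset x) w) + pure (coset y) w \<in> ?E"
        using step.IH R[OF R_bilinear(1)[OF cx w]] R[OF R_bilinear(3)[OF x w]]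
        by (intro pm.span_add[OF pm.span_add[OF pm.span_add]] pm.span_scale) simp_all
      moreover have "pm_scale c x + y \<in> carrier F"
        using step.IH cx by (intro free_algebra_closed(1)) simp_all
      ultimately show ?case by simp
    qed
  qed
  show ?thesis
    using f
  proof (induction f rule: poly_mapping_keys_induct)
    case zero
    show ?case by (rule pm.span_zero)
  next
    case (single k c)
    then obtain h w where "k = (coset h, w)" "h \<in> carrier F" "w \<in> W"
      by (auto simp: envelope_carrier)
    then show ?case using pm.span_scale[of "pure (coset h) w" _ c] pure by simp
  next
    case (add f g)
    then show ?case by (rule pm.span_add)
  qed
qed

text \<open>
  Terms \<open>e\<^sub>i \<otimes> w\<close> and \<open>e\<^sub>i \<otimes> w'\<close> with the same \<open>i\<close> are merged by linearity in the second factor, which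
  gives one coefficient in \<open>W\<close> for every \<open>e\<^sub>i\<close>. The family \<open>w\<close> is total, with values in \<open>W\<close> also outside
  of \<open>J\<close>.
\<close>
lemma tensor_normal_form:
  assumes e: "\<And>i. e i \<in> carrier F"
    and e_span: "carrier F \<subseteq> pm.span (I \<union> range e)"
    and f: "Poly_Mapping.keys f \<subseteq> carrier U \<times> W"
  shows "\<exists>J w. finite J \<and> (\<forall>i. w i \<in> W) \<and> f - (\<Sum>i\<in>J. pure (coset (e i)) (w i)) \<in> R"
  using tensor_spanned[OF assms]
proof (induction rule: pm.span_induct_alt)
  case base
  show ?case using R_closed(1) subspace_0[OF W]
    by (intro exI[of _ "{}"] exI[of _ "\<lambda>_. 0"]) simp
next
  case (step c x y)
  then obtain J w where J: "finite J" "\<And>i. w i \<in> W" "y - (\<Sum>i\<in>J. pure (coset (e i)) (w i)) \<in> R"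
    by blast
  let ?s = "\<lambda>w J. \<Sum>i\<in>J. pure (coset (e i)) (w i)"
  from step.hyps consider "x \<in> R" | k w0 where "x = pure (coset (e k)) w0" "w0 \<in> W" by blast
  then show ?case
  proof cases
    case 1
    have "pm_scale c x + y - ?s w J \<in> R"
      using R_closed(2)[OF R_closed(4)[OF 1] J(3)] by (simp add: add_diff_eq)
    then show ?thesis using J(1,2) by blast
  next
    case 2
    let ?p = "\<lambda>v. pure (coset (e k)) v"
    have c0: "scale c w0 \<in> W" using 2 W by (simp add: subspace_scale)
    have wk: "(if k \<in> J then w k else 0) \<in> W" using J(2) subspace_0[OF W] by simp
    \<comment> \<open>Outside of \<open>J\<close> the value of \<open>w\<close> is arbitrary, so an index that is new to \<open>J\<close> starts from \<open>0\<close>.\<close>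
    define w' where "w' = w(k := (if k \<in> J then w k else 0) + scale c w0)"
    have w': "w' i \<in> W" for i using J(2) c0 wk W by (simp add: w'_def subspace_add)
    have sum: "?s w' (insert k J) = ?p (w' k) + ?s w (J - {k})"
      using J(1) by (simp add: sum.insert_remove w'_def)
    have "y - ?p (if k \<in> J then w k else 0) - ?s w (J - {k}) \<in> R"
    proof (cases "k \<in> J")
      case True
      then show ?thesis using J(3) sum.remove[OF J(1) True, of "\<lambda>i. pure (coset (e i)) (w i)"]
        by (simp add: algebra_simps)
    next
      case False
      then show ?thesis using R_closed(3)[OF J(3) R_pure_zero[OF e]] by (simp add: algebra_simps)
    qed
    then have "(y - ?p (if k \<in> J then w k else 0) - ?s w (J - {k}))
        - (?p (w' k) - ?p (if k \<in> J then w k else 0) - ?p (scale c w0))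
        - (?p (scale c w0) - pm_scale c (?p w0)) \<in> R"
      unfolding w'_def fun_upd_same
      by (rule R_closed(3)[OF R_closed(3)[OF _ R_bilinear(2)[OF e wk c0]] R_bilinear(4)[OF e 2(2)]])
    then have "pm_scale c x + y - ?s w' (insert k J) \<in> R"
      unfolding sum 2(1) by (simp add: algebra_simps del: pm_scale_single)
    then show ?thesis using J(1) w' by blast
  qed
qed

lemma eval_lmult_first:
  assumes "a \<in> carrier U" "Poly_Mapping.keys f \<subseteq> carrier U \<times> W"
  shows "Poly_Mapping.keys (lmult_first U a f) \<subseteq> carrier U \<times> W \<and>
    eval (lmult_first U a f) = env_act scale act a (eval f)"
proof -
  interpret U: ring U by (rule ring_envelope)
  interpret l: Vector_Spaces.linear pm_scale pm_scale "lmult_first U a :: ((('g word \<Rightarrow>\<^sub>0 complex) set \<times> 'm) \<Rightarrow>\<^sub>0 complex) \<Rightarrow> _"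
    by (rule lmult_first_linear)
  obtain g where g: "g \<in> carrier F" "a = coset g" using assms(1) by (auto simp: envelope_carrier)
  interpret g: Vector_Spaces.linear scale scale "free_act scale act g"
    by (rule free_act_letters_linear[OF g(1)])
  show ?thesis
    using assms(2)
  proof (induction f rule: poly_mapping_keys_induct)
    case zero
    show ?case using l.zero by (simp add: eval.zero g env_act_coset_eq g.zero)
  next
    case (single k c)
    then obtain h w where k: "k = (coset h, w)" "h \<in> carrier F" "w \<in> W"
      by (auto simp: envelope_carrier)
    have "lmult_first U a (Poly_Mapping.single k c) = pm_scale c (pure (coset (g * h)) w)"
      using k g by (simp add: lmult_first_def envelope_mult)
    moreover have "Poly_Mapping.single k c = pm_scale c (pure (coset h) w)"
      using k by simp
    moreover have "coset (g * h) \<in> carrier U"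
      using g k by (simp add: envelope_carrier free_algebra_closed)
    moreover have "Poly_Mapping.keys (pm_scale c (pure (coset (g * h)) w)) \<subseteq> {(coset (g * h), w)}"
      by simp
    moreover have "eval (pure (coset (g * h)) w) = env_act scale act a (eval (pure (coset h) w))"
      using g by (simp add: eval_pure env_act_coset_eq free_act_mult)
    moreover have "env_act scale act a (scale c v) = scale c (env_act scale act a v)" for v
      by (simp add: g env_act_coset_eq g.scale)
    ultimately show ?case
      using k(3) by (simp only: eval.scale) blast
  next
    case (add f f')
    have "env_act scale act a (u + v) = env_act scale act a u + env_act scale act a v" for u v
      by (simp add: g env_act_coset_eq g.add)
    with add keys_add[of "lmult_first U a f" "lmult_first U a f'"] show ?case
      unfolding l.add eval.add by (intro conjI) (blast, simp)
  qed
qed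

text \<open>
  If the \<open>e\<^sub>i\<close> span \<open>U\<close> and every element of the module is a unique sum of \<open>e\<^sub>i w\<^sub>i\<close> with \<open>w\<^sub>i \<in> W\<close>, then
  a tensor in normal form is zero as soon as its image is. Hence the kernel of \<open>eval\<close> is exactly the space
  of tensor relations, the fibres of \<open>eval\<close> are exactly the cosets that make up the tensor product, and
  sending \<open>v\<close> to the fibre over \<open>v\<close> is the inverse of \<open>u \<otimes> w \<mapsto> u w\<close>.
\<close>
lemma free_module_iso_tensor:
  assumes e: "\<And>i. e i \<in> carrier F"
    and e_span: "carrier F \<subseteq> pm.span (I \<union> range e)"
    and gen: "\<And>v. v \<in> span {free_act scale act (e i) w | i w. w \<in> W}"
    and indep: "\<And>J w i. finite J \<Longrightarrow> (\<And>i. w i \<in> W) \<Longrightarrow>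
      (\<Sum>i\<in>J. free_act scale act (e i) (w i)) = 0 \<Longrightarrow> i \<in> J \<Longrightarrow> w i = 0"
  shows "module_isomorphic U (env_module scale act) (tensor_module U Wm)"
proof -
  let ?FS = "free_space (carrier U \<times> carrier Wm)"
  define K where "K = {f :: ((('g word \<Rightarrow>\<^sub>0 complex) set \<times> 'm) \<Rightarrow>\<^sub>0 complex). Poly_Mapping.keys f \<subseteq> carrier U \<times> W}"
  have K: "pm.subspace K" unfolding K_def by (rule keys_subspace)
  have e_U: "coset (e i) \<in> carrier U" for i using e by (simp add: envelope_carrier)
  have FS: "carrier ?FS = K" "add ?FS = (+)"
    by (simp_all add: free_space_def K_def Wm_sel)
  have kernel: "f \<in> R" if f: "f \<in> K" "eval f = 0" for f
  proof -
    obtain J w where J: "finite J" "\<And>i. w i \<in> W" "f - (\<Sum>i\<in>J. pure (coset (e i)) (w i)) \<in> R"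
      using tensor_normal_form[of e f, OF e e_span] f(1) unfolding K_def by blast
    have "(\<Sum>i\<in>J. free_act scale act (e i) (w i)) = 0"
      using R_eval[OF J(3)] f(2) by (simp add: eval.diff eval.sum eval_pure env_act_coset_eq)
    then have "w i = 0" if "i \<in> J" for i
      using indep[of J w i, OF J(1) J(2)] that by simp
    then have "(\<Sum>i\<in>J. pure (coset (e i)) (w i)) \<in> R"
      using R_pure_zero[OF e] by (intro R_closed(5)) simp
    from R_closed(2)[OF J(3) this] show ?thesis by simp
  qed
  have surj: "\<exists>f\<in>K. eval f = v" for v
  proof -
    have "subspace (eval ` K)" using K by (rule eval.subspace_image)
    moreover have "{free_act scale act (e i) w | i w. w \<in> W} \<subseteq> eval ` K"
    proof (clarify)
      fix i w assume "w \<in> W"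
      then have "pure (coset (e i)) w \<in> K" using e_U by (simp add: K_def)
      then show "free_act scale act (e i) w \<in> eval ` K"
        by (intro image_eqI[of _ _ "pure (coset (e i)) w"]) (simp_all add: eval_pure env_act_coset_eq)
    qed
    ultimately have "span {free_act scale act (e i) w | i w. w \<in> W} \<subseteq> eval ` K"
      by (intro span_minimal)
    then show ?thesis using gen[of v] by blast
  qed
  define \<Psi> where "\<Psi> v = {f \<in> K. eval f = v}" for v
  have fibre: "\<Psi> (eval f) = R +>\<^bsub>?FS\<^esub> f" if f: "f \<in> K" for f
  proof -
    have c: "R +>\<^bsub>?FS\<^esub> f = {r + f | r. r \<in> R}"
      by (auto simp: a_r_coset_def r_coset_def FS)
    have "g \<in> {r + f | r. r \<in> R}" if "g \<in> K" "eval g = eval f" for g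
    proof -
      have "g - f \<in> R"
        using that f by (intro kernel pm.subspace_diff[OF K]) (simp_all add: eval.diff)
      then show ?thesis by (auto intro!: exI[of _ "g - f"])
    qed
    moreover have "r + f \<in> K \<and> eval (r + f) = eval f" if "r \<in> R" for r
      using pm.subspace_add[OF K _ f, of r] R_keys[OF that] R_eval[OF that]
      by (simp add: K_def eval.add)
    ultimately show ?thesis unfolding c \<Psi>_def by (intro equalityI subsetI) auto
  qed
  have \<Psi>_eq: "\<exists>f\<in>K. eval f = v \<and> \<Psi> v = R +>\<^bsub>?FS\<^esub> f" for v
    using surj[of v] fibre by blast
  have rcosets: "a_rcosets\<^bsub>?FS\<^esub> R = {R +>\<^bsub>?FS\<^esub> f | f. f \<in> K}"
    unfolding A_RCOSETS_def' FS by blast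
  have bij: "bij_betw \<Psi> UNIV (a_rcosets\<^bsub>?FS\<^esub> R)"
  proof (rule bij_betwI')
    show "\<Psi> v = \<Psi> w \<longleftrightarrow> v = w" for v w
      using surj[of v] by (auto simp: \<Psi>_def)
    show "\<Psi> v \<in> a_rcosets\<^bsub>?FS\<^esub> R" for v
      using \<Psi>_eq[of v] unfolding rcosets by blast
    show "\<exists>v\<in>UNIV. X = \<Psi> v" if X: "X \<in> a_rcosets\<^bsub>?FS\<^esub> R" for X
    proof -
      obtain f where "f \<in> K" "X = R +>\<^bsub>?FS\<^esub> f"
        using X unfolding rcosets by blast
      then show ?thesis using fibre by blast
    qed
  qed
  have \<Psi>_add: "\<Psi> (v + w) = \<Psi> v <+>\<^bsub>?FS\<^esub> \<Psi> w" for v w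
  proof -
    have "\<Psi> v <+>\<^bsub>?FS\<^esub> \<Psi> w = {f + g | f g. f \<in> \<Psi> v \<and> g \<in> \<Psi> w}"
      by (auto simp: set_add_def set_mult_def FS)
    also have "\<dots> = \<Psi> (v + w)"
    proof (intro equalityI subsetI)
      fix h assume h: "h \<in> \<Psi> (v + w)"
      obtain f where f: "f \<in> K" "eval f = v" using surj by blast
      then have "f \<in> \<Psi> v" "h - f \<in> \<Psi> w"
        using h pm.subspace_diff[OF K, of h f] by (simp_all add: \<Psi>_def eval.diff)
      moreover have "h = f + (h - f)" by simp
      ultimately show "h \<in> {f + g | f g. f \<in> \<Psi> v \<and> g \<in> \<Psi> w}" by blast
    next
      fix h assume "h \<in> {f + g | f g. f \<in> \<Psi> v \<and> g \<in> \<Psi> w}"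
      then obtain f g where "h = f + g" "f \<in> \<Psi> v" "g \<in> \<Psi> w" by blast
      then show "h \<in> \<Psi> (v + w)"
        using pm.subspace_add[OF K, of f g] by (simp add: \<Psi>_def eval.add)
    qed
    finally show ?thesis by simp
  qed
  have \<Psi>_smult: "\<Psi> (env_act scale act a v) = a \<odot>\<^bsub>tensor_module U Wm\<^esub> \<Psi> v" if a: "a \<in> carrier U" for a v
  proof -
    obtain f where f: "f \<in> K" "eval f = v" "\<Psi> v = R +>\<^bsub>?FS\<^esub> f" using \<Psi>_eq by blast
    have "a \<otimes>\<^bsub>U\<^esub> (c \<odot>\<^bsub>U\<^esub> u) = c \<odot>\<^bsub>U\<^esub> (a \<otimes>\<^bsub>U\<^esub> u)" if "u \<in> carrier U" for c u
      using a that by (auto simp: envelope_carrier envelope_smult envelope_mult free_algebra_closed pm_scale_closed pm_scale_mult_right)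
    then have "a \<odot>\<^bsub>tensor_module U Wm\<^esub> \<Psi> v = R +>\<^bsub>?FS\<^esub> lmult_first U a f"
      unfolding f(3) by (rule tensor_smult_coset[OF ring_envelope a])
    also have "\<dots> = \<Psi> (eval (lmult_first U a f))"
      using eval_lmult_first[OF a, of f] f(1) by (intro fibre[symmetric]) (simp add: K_def)
    also have "eval (lmult_first U a f) = env_act scale act a v"
      using eval_lmult_first[OF a, of f] f by (simp add: K_def)
    finally show ?thesis by simp
  qed
  have "\<Psi> \<in> module_iso U (env_module scale act) (tensor_module U Wm)"
    using bij \<Psi>_add \<Psi>_smult by (simp add: module_iso_def env_module_def tensor_module_def Let_def)
  then show ?thesis by (auto simp: module_isomorphic_def)
qed

end

lemma env_generated_eq_UNIV:
  assumes e: "\<And>i. e i \<in> carrier F"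
    and gen: "\<And>v. v \<in> span {free_act scale act (e i) w | i w. w \<in> W}"
  shows "env_generated scale act U W = UNIV"
proof -
  have "{free_act scale act (e i) w | i w. w \<in> W} \<subseteq> {env_act scale act u w | u w. u \<in> carrier U \<and> w \<in> W}"
  proof clarify
    fix i w assume "w \<in> W"
    moreover have "coset (e i) \<in> carrier U" using e by (simp add: envelope_carrier)
    ultimately show "\<exists>u wa. free_act scale act (e i) w = env_act scale act u wa \<and> u \<in> carrier U \<and> wa \<in> W"
      using env_act_coset_eq by metis
  qed
  then show ?thesis
    unfolding env_generated_def using gen span_mono by blast
qed

end

section \<open>Whittaker modules\<close>

lemma (in lie_module) restrict:
  assumes "lie_subalgebra gscale br H" "H \<subseteq> L"
  shows "closed_lie_module scale gscale br H act"
  using assms(2)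
  by (intro closed_lie_module.intro lie_module.intro lie_module_axioms.intro vector_space_axioms assms(1))
    (simp_all add: subsetD act_linear act_add act_scale act_bracket)

theorem lemma4p3:
  fixes scale :: "complex \<Rightarrow> 'm::ab_group_add \<Rightarrow> 'm"
    and act :: "vf \<Rightarrow> 'm \<Rightarrow> 'm"
  assumes "whittaker_module scale act"
    and "whittaker_type scale act phi1"
  shows "env_generated scale act U_cartan (Wh1 act) = UNIV \<and>
    module_isomorphic U_cartan (env_module scale act)
      (tensor_module U_cartan (subspace_module scale (Wh1 act)))"
proof -
  interpret M: lie_module scale vf_scale vf_bracket S2bar act
    using assms(1) by (simp add: whittaker_module_def)
  interpret H: closed_lie_module scale vf_scale vf_bracket cartan act
    by (rule M.restrict[OF lie_subalgebra.intro cartan_subset_S2bar]) (rule cartan_closed, assumption+)+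
  have del: "del1 \<in> Delta2" "del2 \<in> Delta2" and d: "d1 \<in> cartan" "d2 \<in> cartan"
    by (simp_all add: Delta2_def cartan_def vf.span_base)
  then have S2: "del1 \<in> S2bar" "del2 \<in> S2bar" "d1 \<in> S2bar" "d2 \<in> S2bar"
    using Delta2_subset_S2bar cartan_subset_S2bar by blast+
  note bracket_simps = vf_bracket_def vf_apply_def vf_scale_def d1_def d2_def del1_def del2_def
    t1_def t2_def D1_def D2_def map_poly_pCons pderiv_pCons prod_eq_iff one_pCons
  have brackets: "vf_bracket del1 d1 = del1" "vf_bracket del2 d2 = del2" "vf_bracket del1 del2 = 0"
    "vf_bracket del1 d2 = 0" "vf_bracket del2 d1 = 0" "vf_bracket d1 d2 = 0"
    by (simp_all add: bracket_simps)
  have act0: "act 0 v = 0" for v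
    using M.act_scale[OF S2(1), of 0 v] by simp
  have comm: "act x (act y v) = act y (act x v) + act (vf_bracket x y) v"
    if "x \<in> S2bar" "y \<in> S2bar" for x y v
    using M.act_bracket[OF that] by simp
  \<comment> \<open>The brackets say that each \<open>(\<partial>\<^sub>i, d\<^sub>i)\<close> is a shift pair and that the two pairs commute.\<close>
  interpret C: commuting_shift_pairs scale "act del1" "act d1" "act del2" "act d2"
    by (intro commuting_shift_pairs.intro shift_pair.intro shift_pair_axioms.intro
        commuting_shift_pairs_axioms.intro M.vector_space_axioms M.act_linear S2)
      (simp_all only: comm[OF S2(1,3)] comm[OF S2(2,4)] comm[OF S2(1,2)] comm[OF S2(1,4)]
        comm[OF S2(2,3)] brackets act0 add_0_right)
  define e :: "nat \<times> nat \<Rightarrow> vf word \<Rightarrow>\<^sub>0 complex"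
    where "e k = ffact (letter d1) (fst k) * ffact (letter d2) (snd k)" for k
  have e: "e k \<in> carrier (free_algebra cartan)" for k
    by (simp add: e_def free_algebra_closed ffact_closed letter_closed d)
  have e_span: "carrier (free_algebra cartan) \<subseteq> pm.span (env_ideal vf_scale vf_bracket cartan \<union> range e)"
  proof -
    have "\<exists>a b. z = vf_scale a d1 + vf_scale b d2" if z: "z \<in> cartan" for z
    proof -
      obtain a where "z - vf_scale a d1 \<in> vf.span {d2}"
        using z by (auto simp: cartan_def vf.span_breakdown_eq)
      then obtain b where "z - vf_scale a d1 - vf_scale b d2 = 0"
        by (auto simp: vf.span_breakdown_eq)
      then have "z = vf_scale a d1 + vf_scale b d2" by (simp add: algebra_simps)
      then show ?thesis by blast
    qed
    moreover have "e = (\<lambda>(i, j). ffact (letter d1) i * ffact (letter d2) j)"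
      by (simp add: fun_eq_iff e_def)
    ultimately show ?thesis
      using H.ffact_products_span[OF d brackets(6)] by simp
  qed
  have e_act: "free_act scale act (e k) v = C.X.falling (fst k) (C.Y.falling (snd k) v)" for k v
    by (simp add: e_def H.free_act_mult ffact_closed letter_closed d
        H.free_act_ffact_letter[OF d(1) C.X.shift_pair_axioms]
        H.free_act_ffact_letter[OF d(2) C.Y.shift_pair_axioms])
  have W: "M.subspace (Wh1 act)"
    by (rule M.subspaceI) (simp_all add: Wh1_def C.X.P.zero C.X.P.add C.X.P.scale
        C.Y.P.zero C.Y.P.add C.Y.P.scale)
  have nilpotent: "\<exists>n. (C.X.N ^^ n) v = 0" "\<exists>n. (C.Y.N ^^ n) v = 0" for v
  proof -
    have "C.X.N = (\<lambda>w. act del1 w - scale (phi1 del1) w)" "C.Y.N = (\<lambda>w. act del2 w - scale (phi1 del2) w)"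
      by (simp_all add: fun_eq_iff C.X.N_def C.Y.N_def)
    then show "\<exists>n. (C.X.N ^^ n) v = 0" "\<exists>n. (C.Y.N ^^ n) v = 0"
      using assms(2)[unfolded whittaker_type_def, THEN spec[of _ v], THEN bspec, OF del(1)]
        assms(2)[unfolded whittaker_type_def, THEN spec[of _ v], THEN bspec, OF del(2)]
      by simp_all
  qed
  have gen: "v \<in> M.span {free_act scale act (e k) w | k w. w \<in> Wh1 act}" for v
  proof -
    have "{C.X.falling i (C.Y.falling j w) | i j w. act del1 w = w \<and> act del2 w = w} =
        {free_act scale act (e k) w | k w. w \<in> Wh1 act}"
      by (auto simp: e_act Wh1_def)
    then show ?thesis using C.nilpotent_in_span_falling2[OF nilpotent, of v] by simp
  qed
  have indep: "w k = 0"
    if "finite J" "\<And>k. w k \<in> Wh1 act" "(\<Sum>k\<in>J. free_act scale act (e k) (w k)) = 0" "k \<in> J" for J w k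
    using C.falling2_independent[OF that(1) _ _ _ that(4), of w] that(2,3)
    by (simp add: e_act Wh1_def)
  show ?thesis
  proof
    show "env_generated scale act U_cartan (Wh1 act) = UNIV"
      by (rule H.env_generated_eq_UNIV[of e, OF e gen])
    show "module_isomorphic U_cartan (env_module scale act)
        (tensor_module U_cartan (subspace_module scale (Wh1 act)))"
      by (rule H.free_module_iso_tensor[of "Wh1 act" e, OF W e e_span gen]) (rule indep)
  qed
qed

end
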